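(* Let $m>1$ and $n\ge 1$ be integers. For $i\in\{1,\dots,m\}$ let $A_i\in\mathbb{R}^{n_i\times n}$ and $b_i\in\mathbb{R}^{n_i}$, let $A$ be the matrix obtained by stacking $A_1,\dots,A_m$ and $b$ the vector obtained by stacking $b_1,\dots,b_m$, and suppose that $Ax=b$ has at least one solution. Let $P_i$ be the orthogonal projection matrix onto $\ker A_i$. Suppose that the original neighbor graph $\mathbb{N}(t)$ is independent of time and strongly connected. Suppose each agent $i$ has event times $t_{i1}<t_{i2}<\cdots$ and a state $x_i(t)$ with $A_ix_i(t_{i1})=b_i$, and updates its state asynchronously according to the rule $$x_i(t_{i(k+1)})=x_i(t_{ik})-\frac{1}{m_i(t_{ik})}P_i\Bigl(m_i(t_{ik})x_i(t_{ik})-\sum_{j\in\mathcal{N}_i(t_{ik})}x_j(t_{ik})\Bigr),\qquad k\ge1,$$ where $m_i(t_{ik})$ is the number of labels in $\mathcal{N}_i(t_{ik})$. Then there exists a positive constant $\lambda<1$ for which all $x_i(t_p)$ converge to the same solution to $Ax=b$ as $p\to\infty$, as fast as $\lambda^p$ converges to $0$.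
   Context: Asynchronous setting. Time $t$ takes values in $[0,\infty)$. Agent $i\in\{1,\dots,m\}$ has a strictly increasing infinite sequence of event times $t_{i1},t_{i2},\dots$; $t_{i1}$ is the time agent $i$ initializes its state and $t_{ik}$, $k>1$, are the times at which it updates its state. The state $x_i(t)\in\mathbb{R}^n$ is constant on each half-open interval $[t_{ik},t_{i(k+1)})$, $k\ge1$. There are positive numbers $\bar T_i>T_i$ with $\bar T_i\ge t_{i(k+1)}-t_{ik}\ge T_i$ for all $k\ge1$. No relation between event times of different agents is assumed. For $k>1$, $\mathcal{N}_i(t_{ik})$ is the set of labels of agent $i$'s neighbors at time $t_{ik}$, i.e. of agents whose state $x_j(t_{ik})$ is available (without delay) to agent $i$ at time $t_{ik}$; always $i\in\mathcal{N}_i(t_{ik})$. For $k=1$, $\mathcal{N}_i(t_{i1})=\{i\}$. That the original neighbor graph is independent of time means that there is a fixed directed graph $\mathbb{N}$ on $\{1,\dots,m\}$ with self-arcs at all vertices such that, with $\mathcal{N}_i=\{j:\ (j,i)\text{ is an arc of }\mathbb{N}\}$, one has $\mathcal{N}_i(t_{ik})=\mathcal{N}_i$ for all $i$ and all $k>1$ (all states read by an agent being defined at the time they are read). Common time scale: let $t_1=\max_i t_{i1}$, let $\mathcal{T}$ be the set of all event times of all $m$ agents which are $\ge t_1$, and label its elements $t_1<t_2<\cdots<t_p<\cdots$. "$x_i(t_p)$ converges to $x^\infty$ as fast as $\lambda^p$ converges to $0$" means that there is a constant $c$ with $|x_i(t_p)-x^\infty|_2\le c\lambda^p$ for all $p\ge1$.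 *)

theory Defs
  imports
    Complex_Main
    "Jordan_Normal_Form.Matrix_Kernel"
    "Graph_Theory.Graph_Theory"
begin

definition stack_mats :: "nat \<Rightarrow> real mat list \<Rightarrow> real mat" where
  "stack_mats n As = mat_of_rows n (concat (map rows As))"

definition stack_vecs :: "real vec list \<Rightarrow> real vec" where
  "stack_vecs bs = vec_of_list (concat (map list_of_vec bs))"

definition orthogonal_projection_mat :: "nat \<Rightarrow> real vec set \<Rightarrow> real mat \<Rightarrow> bool" where
  "orthogonal_projection_mat n V P \<longleftrightarrow> P \<in> carrier_mat n n \<and>
     (\<forall>v \<in> carrier_vec n. P *\<^sub>v v \<in> V \<and> (\<forall>w \<in> V. (v - P *\<^sub>v v) \<bullet> w = 0))"

definition norm2_vec :: "real vec \<Rightarrow> real" where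
  "norm2_vec v = sqrt (v \<bullet> v)"

definition in_neighbors :: "nat pair_pre_digraph \<Rightarrow> nat \<Rightarrow> nat set" where
  "in_neighbors N i = {j. (j, i) \<in> parcs N}"

text \<open>Event times are numbered from 1; \<open>t i 0\<close> is irrelevant everywhere below.\<close>

definition common_event_times :: "nat \<Rightarrow> (nat \<Rightarrow> nat \<Rightarrow> real) \<Rightarrow> real set" where
  "common_event_times m t =
     {s. (\<exists>i \<in> {1..m}. \<exists>k \<ge> 1. s = t i k) \<and> s \<ge> Max ((\<lambda>i. t i 1) ` {1..m})}"

definition increasing_enumeration :: "(nat \<Rightarrow> real) \<Rightarrow> real set \<Rightarrow> bool" where
  "increasing_enumeration \<tau> S \<longleftrightarrow> strict_mono_on {1..} \<tau> \<and> \<tau> ` {1..} = S"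

definition converges_as_fast_as_power :: "(nat \<Rightarrow> real vec) \<Rightarrow> real vec \<Rightarrow> real \<Rightarrow> bool" where
  "converges_as_fast_as_power y y_inf r \<longleftrightarrow>
     (\<exists>c. \<forall>p \<ge> 1. norm2_vec (y p - y_inf) \<le> c * r ^ p)"

end

theory Submission
  imports Defs "HOL-Analysis.L2_Norm"
begin

text \<open>Let \<open>u\<close> be the updated state of an agent and \<open>Y j\<close> the states it read. For every solution \<open>w\<close>,
  since the update stays in the solution set of the agent's own equation,
  \<open>\<Sum>\<^sub>j (|u - w|\<^sup>2 + |Y j - u|\<^sup>2 - |Y j - w|\<^sup>2) = 0\<close>. Hence balls around \<open>w\<close> are preserved, and if \<open>u\<close>
  is almost as far from \<open>w\<close> as the \<open>Y j\<close> may be, then all the \<open>Y j\<close> are close to \<open>u\<close>. Tracing this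
  backwards through the strongly connected graph, either the radius of a ball around \<open>w\<close> that
  contains all states shrinks by a fixed factor, or all states of some time window lie close to a
  single point \<open>v\<close>. In the second case \<open>v\<close> nearly solves every equation, so a linear error bound gives
  a solution near \<open>v\<close>, which serves as the centre of a much smaller ball. The centres form a Cauchy
  sequence with geometric rate, whose limit is the common limit of the states.\<close>

section \<open>Averaging with bounded delay in a pseudo-metric\<close>

text \<open>In assumption \<open>step\<close>, \<open>q\<close> is the index at which agent \<open>i\<close> read the states that produced its
  state at index \<open>p\<close>; the inequality is all that is used of averaging and projecting. The last
  conjunct says that \<open>i\<close> updates only once between \<open>q\<close> and \<open>p\<close>, so that going backwards along the
  self-arc of \<open>i\<close> meets all of its earlier states.\<close>

locale delayed_averaging =
  fixes d :: "'a \<Rightarrow> 'a \<Rightarrow> real" and W :: "'a set" and I :: "'i set" and E :: "('i \<times> 'i) set"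
    and y :: "'i \<Rightarrow> nat \<Rightarrow> 'a" and p0 B :: nat and \<kappa> :: real
  assumes d_nonneg: "0 \<le> d u v" and d_self: "d u u = 0" and d_commute: "d u v = d v u"
    and d_triangle: "d u v \<le> d u w + d w v"
    and complete: "\<And>u. (\<And>k. u k \<in> W) \<Longrightarrow> (\<And>e. e > 0 \<Longrightarrow> \<exists>K. \<forall>k\<ge>K. \<forall>l\<ge>K. d (u k) (u l) < e)
      \<Longrightarrow> \<exists>w\<in>W. (\<lambda>k::nat. d (u k) w) \<longlonglongrightarrow> 0"
    and W_nonempty: "W \<noteq> {}"
    and finite_I: "finite I" and I_nonempty: "I \<noteq> {}"
    and E_in: "(j, i) \<in> E \<Longrightarrow> j \<in> I" and E_refl: "i \<in> I \<Longrightarrow> (i, i) \<in> E"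
    and E_connected: "i \<in> I \<Longrightarrow> j \<in> I \<Longrightarrow> (j, i) \<in> E\<^sup>*"
    and error_bound: "\<And>i p r. i \<in> I \<Longrightarrow> p0 \<le> p
      \<Longrightarrow> (\<And>j. j \<in> I \<Longrightarrow> \<exists>p'\<ge>p0. d (y i p) (y j p') \<le> r) \<Longrightarrow> \<exists>w\<in>W. d (y i p) w \<le> \<kappa> * r"
    and kappa_nonneg: "0 \<le> \<kappa>"
    and step: "\<And>i p. i \<in> I \<Longrightarrow> p0 + B \<le> p \<Longrightarrow> \<exists>q<p. p \<le> q + B \<and>
      (\<forall>w\<in>W. (\<Sum>j | (j, i) \<in> E. (d (y i p) w)\<^sup>2 + (d (y j q) (y i p))\<^sup>2 - (d (y j q) w)\<^sup>2) \<le> 0) \<and>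
      (\<forall>p'\<in>{q..p}. y i p' = y i p \<or> y i p' = y i q)"
begin

section \<open>Balls preserved by averaging\<close>

definition averages :: "'i \<Rightarrow> nat \<Rightarrow> nat \<Rightarrow> bool" where
  "averages i p q \<longleftrightarrow> q < p \<and> p \<le> q + B \<and>
      (\<forall>w\<in>W. (\<Sum>j | (j, i) \<in> E. (d (y i p) w)\<^sup>2 + (d (y j q) (y i p))\<^sup>2 - (d (y j q) w)\<^sup>2) \<le> 0) \<and>
      (\<forall>p'\<in>{q..p}. y i p' = y i p \<or> y i p' = y i q)"

definition bounded_from :: "'a \<Rightarrow> real \<Rightarrow> nat \<Rightarrow> bool" where
  "bounded_from w M a \<longleftrightarrow> (\<forall>j\<in>I. \<forall>p\<ge>a. d (y j p) w \<le> M)"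

lemma obtain_averages:
  assumes "i \<in> I" "p0 + B \<le> p" obtains q where "averages i p q"
  using step[OF assms] unfolding averages_def by blast

lemma finite_neighbors: "finite {j. (j, i) \<in> E}"
  using finite_subset[OF _ finite_I] E_in by (metis mem_Collect_eq subsetI)

lemma card_neighbors_pos: "i \<in> I \<Longrightarrow> 0 < card {j. (j, i) \<in> E}"
  using finite_neighbors E_refl card_gt_0_iff by blast

lemma card_neighbors_le: "card {j. (j, i) \<in> E} \<le> card I"
  by (rule card_mono[OF finite_I]) (use E_in in auto)

text \<open>The sum in \<open>averages\<close> only decreases when every input distance to
  \<open>w\<close> is replaced by the common bound \<open>M\<close> and when all squared spreads but
  the one for \<open>j\<close> are dropped. Discarding that last spread gives nonexpansiveness;
  solving for it gives uniform convexity.\<close>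

lemma averages_spread:
  assumes q: "averages i p q" and w: "w \<in> W" and ji: "(j, i) \<in> E"
    and M: "\<And>k. (k, i) \<in> E \<Longrightarrow> d (y k q) w \<le> M"
  shows "(d (y j q) (y i p))\<^sup>2 + real (card {j. (j, i) \<in> E}) * ((d (y i p) w)\<^sup>2 - M\<^sup>2) \<le> 0"
proof -
  let ?N = "{j. (j, i) \<in> E}"
  have "(d (y j q) (y i p))\<^sup>2 + real (card ?N) * ((d (y i p) w)\<^sup>2 - M\<^sup>2)
      \<le> (\<Sum>j\<in>?N. (d (y j q) (y i p))\<^sup>2) + (\<Sum>j\<in>?N. (d (y i p) w)\<^sup>2 - M\<^sup>2)"
    using member_le_sum[of j ?N "\<lambda>j. (d (y j q) (y i p))\<^sup>2"] finite_neighbors ji by auto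
  also have "\<dots> = (\<Sum>j\<in>?N. (d (y i p) w)\<^sup>2 + (d (y j q) (y i p))\<^sup>2 - M\<^sup>2)"
    by (simp add: sum.distrib sum_subtractf algebra_simps)
  also have "\<dots> \<le> (\<Sum>j\<in>?N. (d (y i p) w)\<^sup>2 + (d (y j q) (y i p))\<^sup>2 - (d (y j q) w)\<^sup>2)"
    by (rule sum_mono) (use M d_nonneg in \<open>auto intro!: power_mono\<close>)
  also have "\<dots> \<le> 0" using q w unfolding averages_def by auto
  finally show ?thesis .
qed

text \<open>The self-arc makes the number of inputs positive, so that it can be cancelled, and
  provides an input showing \<open>0 \<le> M\<close>, so that squares can be compared.\<close>

lemma averages_nonexpansive:
  assumes q: "averages i p q" and i: "i \<in> I" and w: "w \<in> W"
    and M: "\<And>k. (k, i) \<in> E \<Longrightarrow> d (y k q) w \<le> M"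
  shows "d (y i p) w \<le> M"
proof -
  have "0 \<le> M" using M[OF E_refl[OF i]] d_nonneg[of "y i q" w] by linarith
  have "real (card {j. (j, i) \<in> E}) * ((d (y i p) w)\<^sup>2 - M\<^sup>2) \<le> 0"
    using averages_spread[OF q w E_refl[OF i] M] zero_le_power2[of "d (y i q) (y i p)"] by linarith
  then have "(d (y i p) w)\<^sup>2 \<le> M\<^sup>2"
    using card_neighbors_pos[OF i] by (simp add: mult_le_0_iff)
  then show ?thesis using \<open>0 \<le> M\<close> power2_le_imp_le by blast
qed

text \<open>An update at an index from \<open>a + B\<close> on reads no earlier than
  \<open>a\<close>, so strong induction spreads the bound from \<open>B\<close> consecutive indices
  to all later ones. A new ball therefore needs to be checked on one window only.\<close>

lemma window_bounded_from:
  assumes w: "w \<in> W" and a: "p0 \<le> a" and win: "\<And>j p. j \<in> I \<Longrightarrow> a \<le> p \<Longrightarrow> p < a + B \<Longrightarrow> d (y j p) w \<le> M"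
  shows "bounded_from w M a"
proof -
  have "\<forall>j\<in>I. a \<le> p \<longrightarrow> d (y j p) w \<le> M" for p
  proof (induction p rule: less_induct)
    case (less p)
    show ?case
    proof (intro ballI impI)
      fix j assume j: "j \<in> I" and ap: "a \<le> p"
      show "d (y j p) w \<le> M"
      proof (cases "p < a + B")
        case True then show ?thesis using win j ap by blast
      next
        case False
        then obtain q where q: "averages j p q" using obtain_averages[OF j, of p] a by auto
        then have "q < p" "a \<le> q" using False unfolding averages_def by auto
        then show ?thesis using averages_nonexpansive[OF q j w] less.IH E_in by blast
      qed
    qed
  qed
  then show ?thesis unfolding bounded_from_def by blast
qed

lemma bounded_fromD: "bounded_from w M a \<Longrightarrow> j \<in> I \<Longrightarrow> a \<le> p \<Longrightarrow> d (y j p) w \<le> M"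
  unfolding bounded_from_def by blast

lemma bounded_from_nonneg: "bounded_from w M a \<Longrightarrow> 0 \<le> M"
  using I_nonempty bounded_fromD d_nonneg by (meson all_not_in_conv order_refl order_trans)

section \<open>Tracing almost extremal values backwards\<close>

text \<open>The update is uniformly convex: a value that stays almost as far from \<open>w\<close> as its
  inputs were forces all of these inputs to be close to it.\<close>

lemma near_step:
  assumes "0 < \<eta>"
  shows "\<exists>\<epsilon>>0. \<epsilon> \<le> 1 \<and> (\<forall>i\<in>I. \<forall>j. \<forall>w\<in>W. \<forall>M a p q. (j, i) \<in> E \<longrightarrow> averages i p q \<longrightarrow> a \<le> q \<longrightarrow> bounded_from w M a
    \<longrightarrow> (1 - \<epsilon>) * M \<le> d (y i p) w \<longrightarrow> d (y j q) (y i p) \<le> \<eta> * M)"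
proof -
  define c where "c = real (card I)"
  have c: "1 \<le> c" unfolding c_def using finite_I I_nonempty by (simp add: Suc_leI card_gt_0_iff)
  \<comment> \<open>Each summand loses at most \<open>2 * \<epsilon> * M\<^sup>2\<close> and there
    are at most \<open>c\<close> of them, so this choice keeps a squared spread below
    \<open>(\<eta> * M)\<^sup>2\<close>. Taking \<open>card I\<close> for the number of neighbors
    makes \<open>\<epsilon>\<close> the same for all agents.\<close>
  define \<epsilon> where "\<epsilon> = min 1 (\<eta>\<^sup>2 / (2 * c))"
  have e: "0 < \<epsilon>" "\<epsilon> \<le> 1" using assms c by (auto simp: \<epsilon>_def)
  have ec: "2 * c * \<epsilon> \<le> \<eta>\<^sup>2"
  proof -
    have "\<epsilon> \<le> \<eta>\<^sup>2 / (2 * c)" by (simp add: \<epsilon>_def)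
    then show ?thesis using c by (simp add: field_simps)
  qed
  have "d (y j q) (y i p) \<le> \<eta> * M"
    if i: "i \<in> I" and w: "w \<in> W" and ji: "(j, i) \<in> E" and q: "averages i p q" "a \<le> q" and M: "bounded_from w M a"
      and D: "(1 - \<epsilon>) * M \<le> d (y i p) w" for i j w M a p q
  proof -
    let ?c = "real (card {j. (j, i) \<in> E})"
    have M0: "0 \<le> M" using bounded_from_nonneg[OF M] .
    have "((1 - \<epsilon>) * M)\<^sup>2 \<le> (d (y i p) w)\<^sup>2" using D M0 e by (intro power_mono) auto
    then have "M\<^sup>2 - (d (y i p) w)\<^sup>2 \<le> M\<^sup>2 - (1 - \<epsilon>)\<^sup>2 * M\<^sup>2" by (simp add: power_mult_distrib)
    also have "\<dots> = (2 * \<epsilon> - \<epsilon>\<^sup>2) * M\<^sup>2" by (simp add: power2_eq_square algebra_simps)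
    also have "\<dots> \<le> 2 * \<epsilon> * M\<^sup>2" by (intro mult_right_mono) auto
    finally have gap: "M\<^sup>2 - (d (y i p) w)\<^sup>2 \<le> 2 * \<epsilon> * M\<^sup>2" .
    have "(d (y j q) (y i p))\<^sup>2 \<le> ?c * (M\<^sup>2 - (d (y i p) w)\<^sup>2)"
      using averages_spread[OF q(1) w ji, of M] bounded_fromD[OF M] E_in q(2) by (auto simp: algebra_simps)
    also have "\<dots> \<le> ?c * (2 * \<epsilon> * M\<^sup>2)" using gap by (rule mult_left_mono) simp
    also have "\<dots> \<le> c * (2 * \<epsilon> * M\<^sup>2)"
      using card_neighbors_le e by (intro mult_right_mono) (auto simp: c_def)
    also have "\<dots> \<le> \<eta>\<^sup>2 * M\<^sup>2" using mult_right_mono[OF ec, of "M\<^sup>2"] by (simp add: algebra_simps)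
    finally have "(d (y j q) (y i p))\<^sup>2 \<le> (\<eta> * M)\<^sup>2" by (simp add: power_mult_distrib)
    then show ?thesis by (rule power2_le_imp_le) (use assms M0 in simp)
  qed
  then show ?thesis using e by blast
qed

text \<open>Given closeness after the first backward step, an input of \<open>y i p\<close> is again almost extremal,
  so backward steps can be chained.\<close>

lemma near_chain:
  assumes "0 < \<eta>" "0 < \<epsilon>'" "\<epsilon>' \<le> 1"
  shows "\<exists>\<epsilon>>0. \<epsilon> \<le> 1 \<and> (\<forall>i\<in>I. \<forall>j. \<forall>w\<in>W. \<forall>M a p q. (j, i) \<in> E \<longrightarrow> averages i p q \<longrightarrow> a \<le> q \<longrightarrow> bounded_from w M a
    \<longrightarrow> (1 - \<epsilon>) * M \<le> d (y i p) w
    \<longrightarrow> d (y j q) (y i p) \<le> \<eta> * M \<and> (1 - \<epsilon>') * M \<le> d (y j q) w)"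
proof -
  \<comment> \<open>Half of the tolerance \<open>\<epsilon>'\<close> pays for the distance between
    input and output, the other half for the gap between \<open>M\<close> and the distance of the
    output from \<open>w\<close>.\<close>
  have "0 < min \<eta> (\<epsilon>' / 2)" using assms by auto
  from near_step[OF this] obtain \<epsilon>1 where e1: "0 < \<epsilon>1" "\<epsilon>1 \<le> 1"
    and *: "\<forall>i\<in>I. \<forall>j. \<forall>w\<in>W. \<forall>M a p q. (j, i) \<in> E \<longrightarrow> averages i p q \<longrightarrow> a \<le> q \<longrightarrow> bounded_from w M a
    \<longrightarrow> (1 - \<epsilon>1) * M \<le> d (y i p) w \<longrightarrow> d (y j q) (y i p) \<le> min \<eta> (\<epsilon>' / 2) * M"
    by (elim exE conjE) (rule that)
  define \<epsilon> where "\<epsilon> = min \<epsilon>1 (\<epsilon>' / 2)"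
  have "d (y j q) (y i p) \<le> \<eta> * M \<and> (1 - \<epsilon>') * M \<le> d (y j q) w"
    if h: "i \<in> I" "w \<in> W" "(j, i) \<in> E" "averages i p q" "a \<le> q" "bounded_from w M a"
      and D: "(1 - \<epsilon>) * M \<le> d (y i p) w" for i j w M a p q
  proof -
    have M0: "0 \<le> M" using bounded_from_nonneg[OF h(6)] .
    have "(1 - \<epsilon>1) * M \<le> (1 - \<epsilon>) * M" "(1 - \<epsilon>' / 2) * M \<le> (1 - \<epsilon>) * M"
      by (rule mult_right_mono, simp add: \<epsilon>_def, rule M0)+
    then have D1: "(1 - \<epsilon>1) * M \<le> d (y i p) w" "(1 - \<epsilon>' / 2) * M \<le> d (y i p) w" using D by auto
    have n: "d (y j q) (y i p) \<le> min \<eta> (\<epsilon>' / 2) * M" by (rule *[rule_format, OF h D1(1)])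
    moreover have "min \<eta> (\<epsilon>' / 2) * M \<le> \<eta> * M" "min \<eta> (\<epsilon>' / 2) * M \<le> \<epsilon>' / 2 * M"
      by (rule mult_right_mono, simp, rule M0)+
    moreover have "d (y i p) w \<le> d (y j q) (y i p) + d (y j q) w"
      using d_triangle[of "y i p" w "y j q"] d_commute[of "y i p" "y j q"] by simp
    ultimately show ?thesis using D1(2) by (auto simp: algebra_simps)
  qed
  moreover have "0 < \<epsilon>" "\<epsilon> \<le> 1" using e1 assms by (auto simp: \<epsilon>_def)
  ultimately show ?thesis by blast
qed

text \<open>Induction on how far back \<open>p'\<close> may lie. A backward step along the self-arc
  leads to \<open>q < p\<close> with \<open>y i q\<close> again almost extremal. On
  \<open>{q..p}\<close> the agent holds only its values at the two ends; earlier indices are left to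
  the induction hypothesis at \<open>q\<close>. Each step spends half of \<open>\<eta>\<close> and
  up to \<open>B\<close> indices, whence the margin \<open>(L + 1) * B\<close>.\<close>

lemma near_self:
  assumes "0 < \<eta>"
  shows "\<exists>\<epsilon>>0. \<epsilon> \<le> 1 \<and> (\<forall>i\<in>I. \<forall>w\<in>W. \<forall>M a p p'. p0 \<le> a \<longrightarrow> bounded_from w M a
    \<longrightarrow> a + (L + 1) * B \<le> p \<longrightarrow> (1 - \<epsilon>) * M \<le> d (y i p) w
    \<longrightarrow> p \<le> p' + L \<longrightarrow> p' \<le> p \<longrightarrow> d (y i p') (y i p) \<le> \<eta> * M)"
  using assms
proof (induction L arbitrary: \<eta>)
  case 0
  then show ?case
    by (intro exI[of _ 1]) (auto simp: d_self intro!: mult_nonneg_nonneg dest: bounded_from_nonneg)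
next
  case (Suc L)
  from Suc.IH[of "\<eta> / 2"] Suc.prems obtain \<epsilon>1 where e1: "0 < \<epsilon>1" "\<epsilon>1 \<le> 1"
    and *: "\<And>i w M a p p'. i \<in> I \<Longrightarrow> w \<in> W \<Longrightarrow> p0 \<le> a \<Longrightarrow> bounded_from w M a
      \<Longrightarrow> a + (L + 1) * B \<le> p \<Longrightarrow> (1 - \<epsilon>1) * M \<le> d (y i p) w
      \<Longrightarrow> p \<le> p' + L \<Longrightarrow> p' \<le> p \<Longrightarrow> d (y i p') (y i p) \<le> \<eta> / 2 * M" by auto
  from near_chain[of "\<eta> / 2" \<epsilon>1] Suc.prems e1 obtain \<epsilon> where e: "0 < \<epsilon>" "\<epsilon> \<le> 1"
    and **: "\<And>i j w M a p q. i \<in> I \<Longrightarrow> w \<in> W \<Longrightarrow> (j, i) \<in> E \<Longrightarrow> averages i p q \<Longrightarrow> a \<le> q \<Longrightarrow> bounded_from w M a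
    \<Longrightarrow> (1 - \<epsilon>) * M \<le> d (y i p) w
    \<Longrightarrow> d (y j q) (y i p) \<le> \<eta> / 2 * M \<and> (1 - \<epsilon>1) * M \<le> d (y j q) w" by auto
  have "d (y i p') (y i p) \<le> \<eta> * M"
    if h: "i \<in> I" "w \<in> W" "p0 \<le> a" "bounded_from w M a" "a + (Suc L + 1) * B \<le> p"
      "(1 - \<epsilon>) * M \<le> d (y i p) w" "p \<le> p' + Suc L" "p' \<le> p" for i w M a p p'
  proof -
    have M0: "0 \<le> \<eta> / 2 * M" using bounded_from_nonneg[OF h(4)] Suc.prems by simp
    obtain q where q: "averages i p q" using obtain_averages[OF h(1), of p] h(3,5) by auto
    then have qp: "q < p" "p \<le> q + B" "\<And>p'. p' \<in> {q..p} \<Longrightarrow> y i p' = y i p \<or> y i p' = y i q"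
      unfolding averages_def by auto
    have aq: "a + (L + 1) * B \<le> q" using qp(2) h(5) by simp
    have n: "d (y i q) (y i p) \<le> \<eta> / 2 * M" "(1 - \<epsilon>1) * M \<le> d (y i q) w"
      using **[OF h(1,2) E_refl[OF h(1)] q _ h(4,6)] aq by auto
    show ?thesis
    proof (cases "q \<le> p'")
      case True
      then have "y i p' = y i p \<or> y i p' = y i q" using qp(3) h(8) by auto
      then show ?thesis using n(1) M0 d_self[of "y i p"] by auto
    next
      case False
      then have "d (y i p') (y i q) \<le> \<eta> / 2 * M"
        using *[OF h(1-4) aq n(2), of p'] h(7) qp(1) by auto
      then show ?thesis using n(1) d_triangle[of "y i p'" "y i p" "y i q"] by simp
    qed
  qed
  then show ?case using e by blast
qed

text \<open>Induction on the path: its last arc is one backward step, the rest is traced from the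
  value read, and at \<open>j\<close> itself \<open>near_self\<close> takes over. The witness
  \<open>l\<close> counts arcs, so \<open>p' + l * B \<le> p\<close> keeps \<open>p'\<close> at or
  before the index at which \<open>j\<close> is reached. It is quantified before \<open>L\<close>
  because the window length is later chosen in terms of \<open>l\<close>.\<close>

lemma near_path:
  assumes "(j, i) \<in> E\<^sup>*" "i \<in> I"
  shows "\<exists>l. \<forall>L. \<forall>\<eta>>0. \<exists>\<epsilon>>0. \<epsilon> \<le> 1 \<and> (\<forall>w\<in>W. \<forall>M a p p'. p0 \<le> a \<longrightarrow> bounded_from w M a
    \<longrightarrow> a + (l + L + 1) * B \<le> p \<longrightarrow> (1 - \<epsilon>) * M \<le> d (y i p) w
    \<longrightarrow> p \<le> p' + L \<longrightarrow> p' + l * B \<le> p \<longrightarrow> d (y j p') (y i p) \<le> \<eta> * M)"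
  using assms
proof (induction rule: rtrancl_induct)
  case base
  show ?case
    by (rule exI[of _ 0]) (use near_self base in fastforce)
next
  case (step k i)
  have kI: "k \<in> I" using E_in step.hyps(2) .
  from step.IH[OF kI] obtain l where l: "\<And>L \<eta>. \<eta> > 0 \<Longrightarrow> \<exists>\<epsilon>>0. \<epsilon> \<le> 1 \<and> (\<forall>w\<in>W. \<forall>M a p p'. p0 \<le> a \<longrightarrow> bounded_from w M a
    \<longrightarrow> a + (l + L + 1) * B \<le> p \<longrightarrow> (1 - \<epsilon>) * M \<le> d (y k p) w
    \<longrightarrow> p \<le> p' + L \<longrightarrow> p' + l * B \<le> p \<longrightarrow> d (y j p') (y k p) \<le> \<eta> * M)" by blast
  show ?case
  proof (rule exI[of _ "Suc l"], intro allI impI)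
    fix L and \<eta> :: real assume eta: "0 < \<eta>"
    from l[of "\<eta> / 2" L] eta obtain \<epsilon>1 where e1: "0 < \<epsilon>1" "\<epsilon>1 \<le> 1"
      and *: "\<And>w M a p p'. w \<in> W \<Longrightarrow> p0 \<le> a \<Longrightarrow> bounded_from w M a
      \<Longrightarrow> a + (l + L + 1) * B \<le> p \<Longrightarrow> (1 - \<epsilon>1) * M \<le> d (y k p) w
      \<Longrightarrow> p \<le> p' + L \<Longrightarrow> p' + l * B \<le> p \<Longrightarrow> d (y j p') (y k p) \<le> \<eta> / 2 * M" by auto
    from near_chain[of "\<eta> / 2" \<epsilon>1] eta e1 obtain \<epsilon> where e: "0 < \<epsilon>" "\<epsilon> \<le> 1"
      and **: "\<And>i j w M a p q. i \<in> I \<Longrightarrow> w \<in> W \<Longrightarrow> (j, i) \<in> E \<Longrightarrow> averages i p q \<Longrightarrow> a \<le> q \<Longrightarrow> bounded_from w M a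
      \<Longrightarrow> (1 - \<epsilon>) * M \<le> d (y i p) w
      \<Longrightarrow> d (y j q) (y i p) \<le> \<eta> / 2 * M \<and> (1 - \<epsilon>1) * M \<le> d (y j q) w" by auto
    have "d (y j p') (y i p) \<le> \<eta> * M"
      if h: "w \<in> W" "p0 \<le> a" "bounded_from w M a" "a + (Suc l + L + 1) * B \<le> p"
        "(1 - \<epsilon>) * M \<le> d (y i p) w" "p \<le> p' + L" "p' + Suc l * B \<le> p" for w M a p p'
    proof -
      obtain q where q: "averages i p q" using obtain_averages[OF step.prems, of p] h(2,4) by auto
      then have qp: "q < p" "p \<le> q + B" unfolding averages_def by auto
      have aq: "a + (l + L + 1) * B \<le> q" using qp(2) h(4) by simp
      have n: "d (y k q) (y i p) \<le> \<eta> / 2 * M" "(1 - \<epsilon>1) * M \<le> d (y k q) w"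
        using **[OF step.prems h(1) step.hyps(2) q _ h(3,5)] aq by auto
      have "d (y j p') (y k q) \<le> \<eta> / 2 * M"
        using *[OF h(1-3) aq n(2), of p'] qp h(6,7) by auto
      then show ?thesis using n(1) d_triangle[of "y j p'" "y i p" "y k q"] by simp
    qed
    then show "\<exists>\<epsilon>>0. \<epsilon> \<le> 1 \<and> (\<forall>w\<in>W. \<forall>M a p p'. p0 \<le> a \<longrightarrow> bounded_from w M a
      \<longrightarrow> a + (Suc l + L + 1) * B \<le> p \<longrightarrow> (1 - \<epsilon>) * M \<le> d (y i p) w
      \<longrightarrow> p \<le> p' + L \<longrightarrow> p' + Suc l * B \<le> p \<longrightarrow> d (y j p') (y i p) \<le> \<eta> * M)"
      using e by blast
  qed
qed

text \<open>There are finitely many pairs of agents, so the largest \<open>l\<close> and the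
  smallest \<open>\<epsilon>\<close> serve them all.\<close>

lemma near_all:
  "\<exists>l. \<forall>L. \<forall>\<eta>>0. \<exists>\<epsilon>>0. \<epsilon> \<le> 1 \<and> (\<forall>i\<in>I. \<forall>j\<in>I. \<forall>w\<in>W. \<forall>M a p p'. p0 \<le> a \<longrightarrow> bounded_from w M a
    \<longrightarrow> a + (l + L + 1) * B \<le> p \<longrightarrow> (1 - \<epsilon>) * M \<le> d (y i p) w
    \<longrightarrow> p \<le> p' + L \<longrightarrow> p' + l * B \<le> p \<longrightarrow> d (y j p') (y i p) \<le> \<eta> * M)"
proof -
  define Q where "Q l L \<eta> \<epsilon> s \<longleftrightarrow> (\<forall>w\<in>W. \<forall>M a p p'. p0 \<le> a \<longrightarrow> bounded_from w M a
    \<longrightarrow> a + (l + L + 1) * B \<le> p \<longrightarrow> (1 - \<epsilon>) * M \<le> d (y (fst s) p) w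
    \<longrightarrow> p \<le> p' + L \<longrightarrow> p' + l * B \<le> p \<longrightarrow> d (y (snd s) p') (y (fst s) p) \<le> \<eta> * M)" for l L \<eta> \<epsilon> s
  \<comment> \<open>A larger \<open>l\<close> admits fewer \<open>p'\<close> and demands more
    margin, and a smaller \<open>\<epsilon>\<close> demands a value closer to extremal. Both changes
    only weaken the claim.\<close>
  have mono: "Q l' L \<eta> \<epsilon>' s" if "Q l L \<eta> \<epsilon> s" "l \<le> l'" "\<epsilon>' \<le> \<epsilon>" for l l' L \<eta> \<epsilon> \<epsilon>' s
    unfolding Q_def
  proof (intro ballI allI impI)
    fix w M a p p' assume h: "w \<in> W" "p0 \<le> a" "bounded_from w M a" "a + (l' + L + 1) * B \<le> p"
      "(1 - \<epsilon>') * M \<le> d (y (fst s) p) w" "p \<le> p' + L" "p' + l' * B \<le> p"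
    have "(1 - \<epsilon>) * M \<le> (1 - \<epsilon>') * M" using that(3) bounded_from_nonneg[OF h(3)] by (intro mult_right_mono) auto
    moreover have "l * B \<le> l' * B" "(l + L + 1) * B \<le> (l' + L + 1) * B" using that(2) by simp_all
    ultimately show "d (y (snd s) p') (y (fst s) p) \<le> \<eta> * M"
      using that(1)[unfolded Q_def, rule_format, OF h(1-3), of p p'] h(4-7) by linarith
  qed
  have fin: "finite (I \<times> I)" "I \<times> I \<noteq> {}" using finite_I I_nonempty by auto
  have "\<forall>s\<in>I \<times> I. \<exists>l. \<forall>L. \<forall>\<eta>>0. \<exists>\<epsilon>>0. \<epsilon> \<le> 1 \<and> Q l L \<eta> \<epsilon> s"
    using near_path E_connected unfolding Q_def by fastforce
  then obtain l where l: "\<And>s L \<eta>. s \<in> I \<times> I \<Longrightarrow> \<eta> > 0 \<Longrightarrow> \<exists>\<epsilon>>0. \<epsilon> \<le> 1 \<and> Q (l s) L \<eta> \<epsilon> s" by metis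
  define l0 where "l0 = Max (l ` (I \<times> I))"
  have l0: "s \<in> I \<times> I \<Longrightarrow> l s \<le> l0" for s unfolding l0_def using fin by (intro Max_ge) auto
  have *: "\<exists>\<epsilon>>0. \<epsilon> \<le> 1 \<and> (\<forall>i\<in>I. \<forall>j\<in>I. Q l0 L \<eta> \<epsilon> (i, j))" if "\<eta> > 0" for L \<eta>
  proof -
    from l[OF _ that, of _ L] obtain e where
      e: "\<And>s. s \<in> I \<times> I \<Longrightarrow> 0 < e s \<and> e s \<le> 1 \<and> Q (l s) L \<eta> (e s) s" by metis
    define \<epsilon> where "\<epsilon> = Min (e ` (I \<times> I))"
    have le: "s \<in> I \<times> I \<Longrightarrow> \<epsilon> \<le> e s" for s unfolding \<epsilon>_def using fin by (intro Min_le) auto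
    have "0 < \<epsilon>" unfolding \<epsilon>_def using fin e by (subst Min_gr_iff) auto
    moreover have "\<epsilon> \<le> 1" using fin(2) le e by (meson all_not_in_conv order_trans)
    moreover have "\<forall>i\<in>I. \<forall>j\<in>I. Q l0 L \<eta> \<epsilon> (i, j)"
    proof (intro ballI)
      fix i j assume "i \<in> I" "j \<in> I"
      then have s: "(i, j) \<in> I \<times> I" by simp
      show "Q l0 L \<eta> \<epsilon> (i, j)" by (rule mono[OF _ l0[OF s] le[OF s]]) (use e[OF s] in blast)
    qed
    ultimately show ?thesis by blast
  qed
  show ?thesis
    by (intro exI[of _ l0] allI impI) (rule *[unfolded Q_def fst_conv snd_conv])
qed

section \<open>Geometric contraction and the common limit\<close>

text \<open>Either no value comes close to the distance \<open>M\<close> from \<open>w\<close> any more, and the radius shrinks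
  with the centre \<open>w\<close> kept; or some value does, so all values cluster around it on a window of
  length \<open>B\<close>, and the error bound supplies a new centre.\<close>

lemma contraction:
  "\<exists>\<rho> S. 0 < \<rho> \<and> \<rho> < 1 \<and> 0 < S \<and> (\<forall>w\<in>W. \<forall>M a. p0 \<le> a \<longrightarrow> bounded_from w M a
     \<longrightarrow> (\<exists>w'\<in>W. bounded_from w' (\<rho> * M) (a + S)))"
proof -
  obtain l where l: "\<And>L \<eta>. \<eta> > 0 \<Longrightarrow> \<exists>\<epsilon>>0. \<epsilon> \<le> 1 \<and> (\<forall>i\<in>I. \<forall>j\<in>I. \<forall>w\<in>W. \<forall>M a p p'. p0 \<le> a \<longrightarrow> bounded_from w M a
    \<longrightarrow> a + (l + L + 1) * B \<le> p \<longrightarrow> (1 - \<epsilon>) * M \<le> d (y i p) w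
    \<longrightarrow> p \<le> p' + L \<longrightarrow> p' + l * B \<le> p \<longrightarrow> d (y j p') (y i p) \<le> \<eta> * M)" using near_all by (elim exE) blast
  \<comment> \<open>The indices \<open>p'\<close> from \<open>p - L\<close> to
    \<open>p - l * B\<close> then include \<open>B\<close> consecutive ones, as
    \<open>window_bounded_from\<close> requires.\<close>
  define L where "L = (l + 1) * B"
  \<comment> \<open>The new centre will be within \<open>\<kappa> * \<eta> * M\<close> of
    \<open>y i p\<close>, and the clustered values within \<open>\<eta> * M\<close>, so all of them
    lie within \<open>M / 2\<close> of the centre.\<close>
  define \<eta> where "\<eta> = 1 / (2 * (\<kappa> + 1))"
  have eta: "0 < \<eta>" "(\<kappa> + 1) * \<eta> = 1 / 2" using kappa_nonneg by (auto simp: \<eta>_def field_simps)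
  from l[OF eta(1), of L] obtain \<epsilon> where e: "0 < \<epsilon>" "\<epsilon> \<le> 1"
    and *: "\<And>i j w M a p p'. i \<in> I \<Longrightarrow> j \<in> I \<Longrightarrow> w \<in> W \<Longrightarrow> p0 \<le> a \<Longrightarrow> bounded_from w M a
    \<Longrightarrow> a + (l + L + 1) * B \<le> p \<Longrightarrow> (1 - \<epsilon>) * M \<le> d (y i p) w
    \<Longrightarrow> p \<le> p' + L \<Longrightarrow> p' + l * B \<le> p \<Longrightarrow> d (y j p') (y i p) \<le> \<eta> * M" by blast
  obtain i0 where i0: "i0 \<in> I" using I_nonempty by blast
  \<comment> \<open>A state is read strictly before the index it serves and at most \<open>B\<close>
    back, which excludes \<open>B = 0\<close>.\<close>
  have B: "1 \<le> B" using obtain_averages[OF i0, of "p0 + B"] unfolding averages_def by fastforce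
  define \<rho> where "\<rho> = max (1 / 2) (1 - \<epsilon>)"
  \<comment> \<open>The last \<open>B\<close> indices before \<open>a + S\<close> are so late that
    going back \<open>L\<close> from any of them still leaves the margin
    \<open>(l + L + 1) * B\<close> above \<open>a\<close>.\<close>
  define S where "S = (l + L + 1) * B + L + B"
  have "\<exists>w'\<in>W. bounded_from w' (\<rho> * M) (a + S)"
    if w: "w \<in> W" and a: "p0 \<le> a" and M: "bounded_from w M a" for w M a
  proof (cases "\<forall>i\<in>I. \<forall>p. a + (S - B) \<le> p \<and> p < a + S \<longrightarrow> d (y i p) w \<le> (1 - \<epsilon>) * M")
    case True
    have M0: "0 \<le> M" using bounded_from_nonneg[OF M] .
    have "bounded_from w ((1 - \<epsilon>) * M) (a + (S - B))"
      by (rule window_bounded_from) (use w a True in \<open>auto simp: S_def\<close>)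
    moreover have "(1 - \<epsilon>) * M \<le> \<rho> * M" by (rule mult_right_mono) (auto simp: \<rho>_def M0)
    ultimately have "bounded_from w (\<rho> * M) (a + S)" unfolding bounded_from_def
      by (meson add_le_mono diff_le_self order_refl order_trans)
    then show ?thesis using w by blast
  next
    case False
    then obtain i p where i: "i \<in> I" and p: "a + (S - B) \<le> p" "p < a + S"
      and D: "(1 - \<epsilon>) * M \<le> d (y i p) w" by force
    have M0: "0 \<le> M" using bounded_from_nonneg[OF M] .
    let ?a = "p - L"
    have La: "a + (l + L + 1) * B + L \<le> p" using p by (simp add: S_def)
    have near: "d (y j p') (y i p) \<le> \<eta> * M" if "j \<in> I" "?a \<le> p'" "p' < ?a + B" for j p'
      by (rule *[OF i that(1) w a M _ D]) (use La that in \<open>auto simp: L_def\<close>)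
    \<comment> \<open>The first index of the cluster window serves as witness for every
      agent.\<close>
    have "\<exists>p'\<ge>p0. d (y i p) (y j p') \<le> \<eta> * M" if "j \<in> I" for j
      by (rule exI[of _ ?a]) (use near[OF that, of ?a] B a La d_commute in auto)
    with error_bound[OF i, of p] obtain w' where w': "w' \<in> W" "d (y i p) w' \<le> \<kappa> * (\<eta> * M)"
      using a La by force
    have "bounded_from w' (\<rho> * M) ?a"
    proof (rule window_bounded_from[OF w'(1)])
      show "p0 \<le> ?a" using a La by simp
      fix j p' assume h: "j \<in> I" "?a \<le> p'" "p' < ?a + B"
      have "d (y j p') w' \<le> \<eta> * M + \<kappa> * (\<eta> * M)"
        using near[OF h] w'(2) d_triangle[of "y j p'" w' "y i p"] by linarith
      also have "\<dots> = (\<kappa> + 1) * \<eta> * M" by (simp add: algebra_simps)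
      also have "\<dots> \<le> \<rho> * M" unfolding eta by (rule mult_right_mono) (auto simp: \<rho>_def M0)
      finally show "d (y j p') w' \<le> \<rho> * M" .
    qed
    then have "bounded_from w' (\<rho> * M) (a + S)" using p unfolding bounded_from_def by auto
    then show ?thesis using w'(1) by blast
  qed
  moreover have "0 < \<rho>" "\<rho> < 1" "0 < S" using e B by (auto simp: \<rho>_def S_def)
  ultimately show ?thesis by blast
qed

lemma exponential_convergence:
  "\<exists>r. 0 < r \<and> r < 1 \<and> (\<exists>w\<in>W. \<forall>i\<in>I. \<exists>c. \<forall>p. d (y i p) w \<le> c * r ^ p)"
proof -
  from contraction obtain \<rho> S where rho: "0 < \<rho>" "\<rho> < 1" and S: "0 < S"
    and con: "\<And>w M a. w \<in> W \<Longrightarrow> p0 \<le> a \<Longrightarrow> bounded_from w M a \<Longrightarrow> \<exists>w'\<in>W. bounded_from w' (\<rho> * M) (a + S)" by metis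
  obtain w0 where w0: "w0 \<in> W" using W_nonempty by blast
  define M where "M = Max ((\<lambda>(j, p). d (y j p) w0) ` (I \<times> {p0..p0 + B}))"
  have M: "bounded_from w0 M p0"
    by (rule window_bounded_from[OF w0 order_refl]) (auto simp: M_def finite_I intro!: Max_ge)
  have M0: "0 \<le> M" using bounded_from_nonneg[OF M] .
  \<comment> \<open>The conjunct \<open>True\<close> fills the place of the relation between
    consecutive terms in \<open>dependent_nat_choice\<close>; the radius of round \<open>k\<close>
    belongs to the invariant itself.\<close>
  have "\<exists>u. \<forall>k. (u k \<in> W \<and> bounded_from (u k) (\<rho> ^ k * M) (p0 + k * S)) \<and> True"
  proof (rule dependent_nat_choice)
    show "\<exists>w. w \<in> W \<and> bounded_from w (\<rho> ^ 0 * M) (p0 + 0 * S)" using w0 M by auto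
    fix w k assume "w \<in> W \<and> bounded_from w (\<rho> ^ k * M) (p0 + k * S)"
    then show "\<exists>w'. (w' \<in> W \<and> bounded_from w' (\<rho> ^ Suc k * M) (p0 + Suc k * S)) \<and> True"
      using con[of w "p0 + k * S" "\<rho> ^ k * M"] by (auto simp: algebra_simps)
  qed
  then obtain u where uW: "\<And>k. u k \<in> W" and u: "\<And>k. bounded_from (u k) (\<rho> ^ k * M) (p0 + k * S)" by blast
  obtain i0 where i0: "i0 \<in> I" using I_nonempty by blast
  \<comment> \<open>The state of \<open>i0\<close> at \<open>p0 + l * S\<close> lies in both balls,
    since ball \<open>k\<close> holds from \<open>p0 + k * S\<close> on.\<close>
  have near: "d (u k) (u l) \<le> 2 * M * \<rho> ^ k" if "k \<le> l" for k l
  proof -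
    have "d (y i0 (p0 + l * S)) (u k) \<le> \<rho> ^ k * M"
      by (rule bounded_fromD[OF u i0]) (use that in auto)
    moreover have "d (y i0 (p0 + l * S)) (u l) \<le> \<rho> ^ l * M" by (rule bounded_fromD[OF u i0]) auto
    moreover have "\<rho> ^ l * M \<le> \<rho> ^ k * M"
      using that rho M0 by (intro mult_right_mono power_decreasing) auto
    ultimately show ?thesis
      using d_triangle[of "u k" "u l" "y i0 (p0 + l * S)"] d_commute[of "u k"] by (simp add: algebra_simps)
  qed
  have "(\<lambda>k. 2 * M * \<rho> ^ k) \<longlonglongrightarrow> 2 * M * 0"
    using rho by (intro tendsto_mult_left LIMSEQ_realpow_zero) auto
  then have lim: "(\<lambda>k. 2 * M * \<rho> ^ k) \<longlonglongrightarrow> 0" by simp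
  have "\<exists>K. \<forall>k\<ge>K. \<forall>l\<ge>K. d (u k) (u l) < e" if "e > 0" for e
  proof -
    from order_tendstoD(2)[OF lim that] obtain K where K: "\<And>k. k \<ge> K \<Longrightarrow> 2 * M * \<rho> ^ k < e"
      unfolding eventually_sequentially by blast
    have "d (u k) (u l) < e" if "k \<ge> K" "l \<ge> K" for k l
      using near[of k l] near[of l k] K that d_commute[of "u k" "u l"] by (metis le_less_trans nle_le)
    then show ?thesis by blast
  qed
  from complete[OF uW this] obtain w where w: "w \<in> W" "(\<lambda>k. d (u k) w) \<longlonglongrightarrow> 0" by blast
  \<comment> \<open>The bound on \<open>d (u k) (u l)\<close> does not involve \<open>l\<close>, so
    it survives the limit in \<open>l\<close>.\<close>
  have uw: "d (u k) w \<le> 2 * M * \<rho> ^ k" for k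
  proof (rule LIMSEQ_le_const)
    show "(\<lambda>l. 2 * M * \<rho> ^ k + d (u l) w) \<longlonglongrightarrow> 2 * M * \<rho> ^ k"
      using tendsto_add[OF tendsto_const w(2)] by simp
    show "\<exists>N. \<forall>l\<ge>N. d (u k) w \<le> 2 * M * \<rho> ^ k + d (u l) w"
      using near d_triangle[of "u k" w] by (meson add_right_mono order_trans)
  qed
  \<comment> \<open>A round of \<open>S\<close> indices contracts by \<open>\<rho>\<close>, so a
    single index accounts for the \<open>S\<close>-th root.\<close>
  define r where "r = root S \<rho>"
  have r: "0 < r" "r < 1" "r ^ S = \<rho>" using rho S by (auto simp: r_def)
  \<comment> \<open>\<open>3 * M\<close> is the factor \<open>M\<close> from ball \<open>k\<close>
    plus \<open>2 * M\<close> from its centre. The index \<open>p\<close> may reach the start of the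
    next round, which costs a factor \<open>\<rho>\<close>, and rounds are counted from
    \<open>p0\<close>; hence the denominator.\<close>
  have tail: "d (y i p) w \<le> 3 * M / (\<rho> * r ^ p0) * r ^ p" if "i \<in> I" "p0 \<le> p" for i p
  proof -
    define k where "k = (p - p0) div S"
    have k1: "p0 + k * S \<le> p" using that(2) div_times_less_eq_dividend[of "p - p0" S] unfolding k_def by linarith
    have k2: "p \<le> p0 + (k + 1) * S"
      using dividend_less_div_times[OF S, of "p - p0"] unfolding k_def by (simp add: algebra_simps)
    have "d (y i p) w \<le> d (y i p) (u k) + d (u k) w" by (rule d_triangle)
    also have "\<dots> \<le> \<rho> ^ k * M + 2 * M * \<rho> ^ k" using bounded_fromD[OF u that(1) k1] uw by (rule add_mono)
    also have "\<dots> = 3 * M / (\<rho> * r ^ p0) * (r ^ p0 * \<rho> ^ (k + 1))" using rho(1) r(1) by (simp add: field_simps)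
    also have "\<rho> ^ (k + 1) = r ^ ((k + 1) * S)"
      unfolding r(3)[symmetric] power_mult[symmetric] by (simp only: mult.commute)
    also have "r ^ p0 * \<dots> = r ^ (p0 + (k + 1) * S)" by (rule power_add[symmetric])
    also have "3 * M / (\<rho> * r ^ p0) * \<dots> \<le> 3 * M / (\<rho> * r ^ p0) * r ^ p"
      using r rho M0 k2 by (intro mult_left_mono power_decreasing) auto
    finally show ?thesis .
  qed
  have "\<exists>c. \<forall>p. d (y i p) w \<le> c * r ^ p" if i: "i \<in> I" for i
  proof -
    \<comment> \<open>The sum of the finitely many earlier ratios extends the bound to
      \<open>p < p0\<close>.\<close>
    define c where "c = 3 * M / (\<rho> * r ^ p0) + (\<Sum>p<p0. d (y i p) w / r ^ p)"
    have s0: "0 \<le> (\<Sum>p<p0. d (y i p) w / r ^ p)" using d_nonneg r by (intro sum_nonneg) auto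
    have c0: "0 \<le> 3 * M / (\<rho> * r ^ p0)" using M0 rho r by simp
    have "d (y i p) w \<le> c * r ^ p" for p
    proof (cases "p0 \<le> p")
      case True
      have "3 * M / (\<rho> * r ^ p0) * r ^ p \<le> c * r ^ p"
        using s0 r by (intro mult_right_mono) (auto simp: c_def)
      then show ?thesis using tail[OF i True] by linarith
    next
      case False
      then have "d (y i p) w / r ^ p \<le> c"
        using member_le_sum[of p "{..<p0}" "\<lambda>p. d (y i p) w / r ^ p"] c0 d_nonneg r by (auto simp: c_def)
      then show ?thesis using r by (simp add: divide_le_eq)
    qed
    then show ?thesis by blast
  qed
  then show ?thesis using r w(1) by blast
qed

end

section \<open>Linear systems and projections\<close>

definition coord_norm :: "nat \<Rightarrow> real vec \<Rightarrow> real" where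
  "coord_norm n u = L2_set (\<lambda>l. u $ l) {..<n}"

text \<open>Agrees with the norm of \<open>u - v\<close> on \<open>carrier_vec n\<close>, but is symmetric and satisfies the
  triangle inequality on all vectors, whatever their dimensions.\<close>

definition coord_dist :: "nat \<Rightarrow> real vec \<Rightarrow> real vec \<Rightarrow> real" where
  "coord_dist n u v = L2_set (\<lambda>l. u $ l - v $ l) {..<n}"

lemma coord_dist_eq_norm:
  "u \<in> carrier_vec n \<Longrightarrow> v \<in> carrier_vec n \<Longrightarrow> coord_dist n u v = coord_norm n (u - v)"
  unfolding coord_dist_def coord_norm_def by (intro L2_set_cong) auto

lemma norm2_vec_diff:
  "u \<in> carrier_vec n \<Longrightarrow> v \<in> carrier_vec n \<Longrightarrow> norm2_vec (u - v) = coord_dist n u v"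
  by (auto simp: norm2_vec_def coord_dist_def L2_set_def scalar_prod_def power2_eq_square atLeast0LessThan
      intro!: sum.cong)

lemma coord_dist_nonneg: "0 \<le> coord_dist n u v" by (simp add: coord_dist_def)

lemma coord_dist_self: "coord_dist n u u = 0" by (simp add: coord_dist_def L2_set_def)

lemma coord_dist_commute: "coord_dist n u v = coord_dist n v u"
  by (simp add: coord_dist_def L2_set_def power2_commute)

lemma coord_dist_triangle: "coord_dist n u v \<le> coord_dist n u w + coord_dist n w v"
  using L2_set_triangle_ineq[of "\<lambda>l. u $ l - w $ l" "\<lambda>l. w $ l - v $ l" "{..<n}"]
  by (simp add: coord_dist_def)

lemma coord_dist_power2: "(coord_dist n u v)\<^sup>2 = (\<Sum>l<n. (u $ l - v $ l)\<^sup>2)"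
  by (simp add: coord_dist_def L2_set_def sum_nonneg)

lemma coord_dist_component: "l < n \<Longrightarrow> \<bar>u $ l - v $ l\<bar> \<le> coord_dist n u v"
  using member_le_L2_set[of "{..<n}" l "\<lambda>l. \<bar>u $ l - v $ l\<bar>"]
  by (simp add: coord_dist_def L2_set_def)

lemma abs_scalar_prod_le:
  assumes "v \<in> carrier_vec n" shows "\<bar>u \<bullet> v\<bar> \<le> coord_norm n u * coord_norm n v"
proof -
  have "\<bar>u \<bullet> v\<bar> \<le> (\<Sum>l\<in>{..<n}. \<bar>u $ l\<bar> * \<bar>v $ l\<bar>)"
    using assms sum_abs[of "\<lambda>l. u $ l * v $ l" "{..<n}"]
    by (simp add: scalar_prod_def abs_mult atLeast0LessThan)
  also have "\<dots> \<le> coord_norm n u * coord_norm n v" unfolding coord_norm_def by (rule L2_set_mult_ineq)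
  finally show ?thesis .
qed

lemma coord_norm_smult: "coord_norm n (a \<cdot>\<^sub>v g) = \<bar>a\<bar> * coord_norm n g" if "g \<in> carrier_vec n"
proof -
  have "coord_norm n (a \<cdot>\<^sub>v g) = L2_set (\<lambda>l. a * g $ l) {..<n}"
    unfolding coord_norm_def by (rule L2_set_cong) (use that in auto)
  then show ?thesis
    by (simp add: coord_norm_def L2_set_def power_mult_distrib sum_distrib_left[symmetric] real_sqrt_mult)
qed

section \<open>Error bound and completeness for solution sets\<close>

text \<open>A Hoffman bound for homogeneous equations, by induction on the rows. If the new row
  vanishes on the solution space of the old ones, the old approximant works. Otherwise this space
  contains \<open>g\<close> with \<open>r \<bullet> g \<noteq> 0\<close>, and moving along
  \<open>g\<close> repairs the new equation without disturbing the others.\<close>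

lemma linear_system_error_bound:
  assumes "finite R" "R \<subseteq> carrier_vec n"
  shows "\<exists>\<kappa>\<ge>0. \<forall>v\<in>carrier_vec n. \<exists>u\<in>carrier_vec n. (\<forall>r\<in>R. r \<bullet> u = 0) \<and> coord_dist n v u \<le> \<kappa> * (\<Sum>r\<in>R. \<bar>r \<bullet> v\<bar>)"
  using assms
proof (induction R rule: finite_induct)
  case empty
  show ?case by (intro exI[of _ 0]) (auto intro!: bexI simp: coord_dist_self)
next
  case (insert r R)
  then obtain \<kappa> where k: "\<kappa> \<ge> 0" and IH: "\<And>v. v \<in> carrier_vec n
      \<Longrightarrow> \<exists>u\<in>carrier_vec n. (\<forall>r\<in>R. r \<bullet> u = 0) \<and> coord_dist n v u \<le> \<kappa> * (\<Sum>r\<in>R. \<bar>r \<bullet> v\<bar>)"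
    by auto
  have r: "r \<in> carrier_vec n" and R: "\<And>s. s \<in> R \<Longrightarrow> s \<in> carrier_vec n" using insert.prems by auto
  show ?case
  proof (cases "\<forall>u\<in>carrier_vec n. (\<forall>s\<in>R. s \<bullet> u = 0) \<longrightarrow> r \<bullet> u = 0")
    case True
    have "\<exists>u\<in>carrier_vec n. (\<forall>s\<in>insert r R. s \<bullet> u = 0) \<and> coord_dist n v u \<le> \<kappa> * (\<Sum>s\<in>insert r R. \<bar>s \<bullet> v\<bar>)"
      if v: "v \<in> carrier_vec n" for v
    proof -
      obtain u where u: "u \<in> carrier_vec n" "\<forall>s\<in>R. s \<bullet> u = 0" "coord_dist n v u \<le> \<kappa> * (\<Sum>r\<in>R. \<bar>r \<bullet> v\<bar>)"
        using IH[OF v] by blast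
      moreover have "\<kappa> * (\<Sum>r\<in>R. \<bar>r \<bullet> v\<bar>) \<le> \<kappa> * (\<Sum>s\<in>insert r R. \<bar>s \<bullet> v\<bar>)"
        using k insert.hyps by (intro mult_left_mono) auto
      ultimately show ?thesis using True by (intro bexI[of _ u]) auto
    qed
    then show ?thesis using k by blast
  next
    case False
    then obtain g where g: "g \<in> carrier_vec n" "\<forall>s\<in>R. s \<bullet> g = 0" "r \<bullet> g \<noteq> 0" by blast
    \<comment> \<open>The distance travelled along \<open>g\<close> per unit of residual of
      \<open>r\<close>.\<close>
    define N where "N = coord_norm n g / \<bar>r \<bullet> g\<bar>"
    have N0: "0 \<le> N" by (simp add: N_def coord_norm_def)
    have r0: "0 \<le> coord_norm n r" by (simp add: coord_norm_def)
    \<comment> \<open>Passing from \<open>v\<close> to \<open>u0\<close> costs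
      \<open>\<kappa>\<close> times the total residual and raises the residual of \<open>r\<close>
      by at most \<open>coord_norm n r * \<kappa>\<close> times it; \<open>N\<close> converts the
      raised residual into a distance.\<close>
    define \<kappa>' where "\<kappa>' = \<kappa> + (1 + coord_norm n r * \<kappa>) * N"
    have "\<exists>u\<in>carrier_vec n. (\<forall>s\<in>insert r R. s \<bullet> u = 0) \<and> coord_dist n v u \<le> \<kappa>' * (\<Sum>s\<in>insert r R. \<bar>s \<bullet> v\<bar>)"
      if v: "v \<in> carrier_vec n" for v
    proof -
      define S where "S = (\<Sum>r\<in>R. \<bar>r \<bullet> v\<bar>)"
      have S0: "0 \<le> S" by (auto simp: S_def intro: sum_nonneg)
      obtain u0 where u0: "u0 \<in> carrier_vec n" "\<forall>s\<in>R. s \<bullet> u0 = 0" "coord_dist n v u0 \<le> \<kappa> * S"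
        using IH[OF v] S_def by blast
      define a where "a = r \<bullet> u0 / (r \<bullet> g)"
      define u where "u = u0 - a \<cdot>\<^sub>v g"
      have u: "u \<in> carrier_vec n" using u0 g by (simp add: u_def)
      have "s \<bullet> u = s \<bullet> u0 - a * (s \<bullet> g)" if "s \<in> carrier_vec n" for s
        using that u0 g unfolding u_def by (simp add: scalar_prod_minus_distrib)
      then have z: "\<forall>s\<in>insert r R. s \<bullet> u = 0" using r R u0 g by (auto simp: a_def)
      have "r \<bullet> u0 = r \<bullet> v - r \<bullet> (v - u0)"
        using r v u0 by (simp add: scalar_prod_minus_distrib)
      then have "\<bar>r \<bullet> u0\<bar> \<le> \<bar>r \<bullet> v\<bar> + coord_norm n r * coord_dist n v u0"
        using abs_scalar_prod_le[of "v - u0" n r] v u0 by (simp add: coord_dist_eq_norm)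
      also have "\<dots> \<le> \<bar>r \<bullet> v\<bar> + coord_norm n r * (\<kappa> * S)" using u0(3) r0 by (simp add: mult_left_mono)
      finally have ru: "\<bar>r \<bullet> u0\<bar> \<le> \<bar>r \<bullet> v\<bar> + coord_norm n r * (\<kappa> * S)" .
      have "coord_dist n u0 u = coord_norm n (a \<cdot>\<^sub>v g)"
        unfolding coord_dist_def coord_norm_def u_def by (rule L2_set_cong) (use u0 g in auto)
      also have "\<dots> = \<bar>r \<bullet> u0\<bar> * N" using coord_norm_smult[OF g(1)] by (simp add: a_def N_def)
      also have "\<dots> \<le> (\<bar>r \<bullet> v\<bar> + coord_norm n r * (\<kappa> * S)) * N" using ru N0 by (rule mult_right_mono)
      finally have "coord_dist n v u \<le> \<kappa> * S + (\<bar>r \<bullet> v\<bar> + coord_norm n r * (\<kappa> * S)) * N"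
        using coord_dist_triangle[of n v u u0] u0(3) by linarith
      also have "\<dots> \<le> \<kappa> * (\<bar>r \<bullet> v\<bar> + S) + ((\<bar>r \<bullet> v\<bar> + S) + coord_norm n r * (\<kappa> * (\<bar>r \<bullet> v\<bar> + S))) * N"
        using k S0 N0 r0 by (intro add_mono mult_mono) auto
      also have "\<dots> = \<kappa>' * (\<bar>r \<bullet> v\<bar> + S)" by (simp add: \<kappa>'_def algebra_simps)
      also have "\<bar>r \<bullet> v\<bar> + S = (\<Sum>s\<in>insert r R. \<bar>s \<bullet> v\<bar>)" using insert.hyps by (simp add: S_def)
      finally show ?thesis using u z by blast
    qed
    moreover have "0 \<le> \<kappa>'" using k N0 r0 by (simp add: \<kappa>'_def)
    ultimately show ?thesis by blast
  qed
qed

lemma mult_mat_vec_eq_iff: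
  assumes "A \<in> carrier_mat d n" "b \<in> carrier_vec d"
  shows "A *\<^sub>v w = b \<longleftrightarrow> (\<forall>l<d. row A l \<bullet> w = b $ l)"
  using assms by (auto simp: vec_eq_iff)

text \<open>Subtracting the known solution \<open>z\<close> makes the system homogeneous. A nearby
  solution of equation \<open>i\<close> bounds the residuals of its rows at \<open>v\<close> by
  \<open>r\<close> times their norms, so \<open>linear_system_error_bound\<close> applies.\<close>

lemma solution_set_error_bound:
  assumes fin: "finite I" and A: "\<And>i. i \<in> I \<Longrightarrow> A i \<in> carrier_mat (d i) n"
    and b: "\<And>i. i \<in> I \<Longrightarrow> b i \<in> carrier_vec (d i)"
    and z: "z \<in> carrier_vec n" "\<And>i. i \<in> I \<Longrightarrow> A i *\<^sub>v z = b i"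
  shows "\<exists>\<kappa>\<ge>0. \<forall>v\<in>carrier_vec n. \<forall>r.
    (\<forall>i\<in>I. \<exists>u\<in>carrier_vec n. A i *\<^sub>v u = b i \<and> coord_dist n v u \<le> r) \<longrightarrow>
    (\<exists>w\<in>carrier_vec n. (\<forall>i\<in>I. A i *\<^sub>v w = b i) \<and> coord_dist n v w \<le> \<kappa> * r)"
proof -
  define R where "R = (\<Union>i\<in>I. set (rows (A i)))"
  have "set (rows (A i)) \<subseteq> carrier_vec n" if "i \<in> I" for i
    using rows_carrier[of "A i"] A[OF that] by simp
  then have R: "finite R" "R \<subseteq> carrier_vec n" using fin by (auto simp: R_def)
  obtain \<kappa> where k: "0 \<le> \<kappa>" and eb: "\<And>v. v \<in> carrier_vec n \<Longrightarrow>
      \<exists>u\<in>carrier_vec n. (\<forall>r\<in>R. r \<bullet> u = 0) \<and> coord_dist n v u \<le> \<kappa> * (\<Sum>r\<in>R. \<bar>r \<bullet> v\<bar>)"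
    using linear_system_error_bound[OF R] by blast
  have "\<exists>w\<in>carrier_vec n. (\<forall>i\<in>I. A i *\<^sub>v w = b i) \<and> coord_dist n v w \<le> (\<kappa> * (\<Sum>s\<in>R. coord_norm n s)) * r"
    if v: "v \<in> carrier_vec n"
      and near: "\<forall>i\<in>I. \<exists>u\<in>carrier_vec n. A i *\<^sub>v u = b i \<and> coord_dist n v u \<le> r" for v r
  proof -
    obtain u where u: "u \<in> carrier_vec n" "\<forall>s\<in>R. s \<bullet> u = 0"
      "coord_dist n (v - z) u \<le> \<kappa> * (\<Sum>s\<in>R. \<bar>s \<bullet> (v - z)\<bar>)"
      using eb[of "v - z"] v z by auto
    have "\<bar>s \<bullet> (v - z)\<bar> \<le> coord_norm n s * r" if s: "s \<in> R" for s
    proof -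
      obtain i where i: "i \<in> I" and "s \<in> set (rows (A i))" using s unfolding R_def by blast
      then obtain l where l: "l < d i" and sl: "s = row (A i) l" using A[OF i] by (auto simp: rows_def)
      obtain x where x: "x \<in> carrier_vec n" "A i *\<^sub>v x = b i" "coord_dist n v x \<le> r" using near i by blast
      \<comment> \<open>Both vectors solve equation \<open>i\<close>, so the nearby \<open>x\<close>
        may replace the distant \<open>z\<close> in the residual.\<close>
      have "s \<bullet> x = s \<bullet> z"
        using mult_mat_vec_eq_iff[OF A[OF i] b[OF i]] x(2) z(2)[OF i] l sl by metis
      moreover have sc: "s \<in> carrier_vec n" using s R by blast
      ultimately have "s \<bullet> (v - z) = s \<bullet> (v - x)" using v z x by (simp add: scalar_prod_minus_distrib)
      also have "\<bar>\<dots>\<bar> \<le> coord_norm n s * coord_dist n v x"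
        using abs_scalar_prod_le[of "v - x" n s] v x by (simp add: coord_dist_eq_norm)
      also have "\<dots> \<le> coord_norm n s * r" using x(3) by (intro mult_left_mono) (auto simp: coord_norm_def)
      finally show ?thesis .
    qed
    then have "\<kappa> * (\<Sum>s\<in>R. \<bar>s \<bullet> (v - z)\<bar>) \<le> \<kappa> * (\<Sum>s\<in>R. coord_norm n s * r)"
      using k by (intro mult_left_mono sum_mono) auto
    moreover have "coord_dist n v (z + u) = coord_dist n (v - z) u"
      unfolding coord_dist_def by (rule L2_set_cong) (use v z u in auto)
    moreover have "A i *\<^sub>v (z + u) = b i" if i: "i \<in> I" for i
    proof -
      have "row (A i) l \<bullet> (z + u) = b i $ l" if l: "l < d i" for l
      proof -
        have "row (A i) l \<in> R" using l i A[OF i] unfolding R_def rows_def by (auto intro!: bexI[of _ i])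
        moreover have "row (A i) l \<bullet> z = b i $ l"
          using mult_mat_vec_eq_iff[OF A[OF i] b[OF i]] z(2)[OF i] l by blast
        ultimately show ?thesis using u z R(2) by (auto simp: scalar_prod_add_distrib)
      qed
      then show ?thesis using mult_mat_vec_eq_iff[OF A[OF i] b[OF i]] by blast
    qed
    ultimately show ?thesis using u z by (intro bexI[of _ "z + u"]) (auto simp: sum_distrib_right mult.assoc)
  qed
  moreover have "0 \<le> \<kappa> * (\<Sum>s\<in>R. coord_norm n s)"
    using k by (auto simp: coord_norm_def intro!: mult_nonneg_nonneg sum_nonneg)
  ultimately show ?thesis by blast
qed

text \<open>Coordinates converge by completeness of the reals, and each row equation is a finite sum
  in the coordinates, so it passes to the limit.\<close>

lemma solution_set_complete:
  assumes A: "\<And>i. i \<in> I \<Longrightarrow> A i \<in> carrier_mat (d i) n"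
    and b: "\<And>i. i \<in> I \<Longrightarrow> b i \<in> carrier_vec (d i)"
    and u: "\<And>k. u k \<in> carrier_vec n" "\<And>k i. i \<in> I \<Longrightarrow> A i *\<^sub>v u k = b i"
    and cauchy: "\<And>e. e > 0 \<Longrightarrow> \<exists>K. \<forall>k\<ge>K. \<forall>l\<ge>K. coord_dist n (u k) (u l) < e"
  shows "\<exists>w\<in>carrier_vec n. (\<forall>i\<in>I. A i *\<^sub>v w = b i) \<and> (\<lambda>k::nat. coord_dist n (u k) w) \<longlonglongrightarrow> 0"
proof -
  have "Cauchy (\<lambda>k. u k $ l)" if "l < n" for l
    unfolding Cauchy_def dist_real_def
    using cauchy coord_dist_component[OF that] by (meson le_less_trans)
  \<comment> \<open>The guard \<open>l < n\<close> inside the existential makes the choice of limits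
    total; values beyond the dimension are arbitrary.\<close>
  then have "\<forall>l. \<exists>c. l < n \<longrightarrow> (\<lambda>k. u k $ l) \<longlonglongrightarrow> c"
    using real_Cauchy_convergent convergent_def by blast
  then obtain c where c: "\<And>l. l < n \<Longrightarrow> (\<lambda>k. u k $ l) \<longlonglongrightarrow> c l" by metis
  define w where "w = vec n c"
  have w: "w \<in> carrier_vec n" by (simp add: w_def)
  have lim: "(\<lambda>k. u k $ l) \<longlonglongrightarrow> w $ l" if "l < n" for l using c that by (simp add: w_def)
  have "(\<lambda>k. coord_dist n (u k) w) \<longlonglongrightarrow> 0"
  proof (rule tendsto_sandwich)
    show "\<forall>\<^sub>F k in sequentially. 0 \<le> coord_dist n (u k) w" by (simp add: coord_dist_nonneg)
    show "\<forall>\<^sub>F k in sequentially. coord_dist n (u k) w \<le> (\<Sum>l<n. \<bar>u k $ l - w $ l\<bar>)"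
      by (simp add: coord_dist_def L2_set_le_sum_abs)
    have "(\<lambda>k. \<Sum>l<n. \<bar>u k $ l - w $ l\<bar>) \<longlonglongrightarrow> (\<Sum>l<n. \<bar>w $ l - w $ l\<bar>)"
      using lim by (intro tendsto_intros) auto
    then show "(\<lambda>k. \<Sum>l<n. \<bar>u k $ l - w $ l\<bar>) \<longlonglongrightarrow> 0" by simp
  qed simp
  moreover have "A i *\<^sub>v w = b i" if i: "i \<in> I" for i
  proof -
    have "row (A i) l \<bullet> w = b i $ l" if l: "l < d i" for l
    proof -
      have "(\<lambda>k. \<Sum>j\<in>{0..<n}. row (A i) l $ j * u k $ j) \<longlonglongrightarrow> (\<Sum>j\<in>{0..<n}. row (A i) l $ j * w $ j)"
        using lim by (intro tendsto_intros) auto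
      moreover have "(\<Sum>j\<in>{0..<n}. row (A i) l $ j * u k $ j) = b i $ l" for k
      proof -
        have "row (A i) l \<bullet> u k = b i $ l"
          using mult_mat_vec_eq_iff[OF A[OF i] b[OF i]] u(2)[OF i] l by blast
        then show ?thesis using u(1)[of k] by (simp add: scalar_prod_def)
      qed
      ultimately have "(\<lambda>k::nat. b i $ l) \<longlonglongrightarrow> (\<Sum>j\<in>{0..<n}. row (A i) l $ j * w $ j)" by simp
      then have "(\<Sum>j\<in>{0..<n}. row (A i) l $ j * w $ j) = b i $ l"
        using LIMSEQ_unique tendsto_const by blast
      then show ?thesis using w by (simp add: scalar_prod_def)
    qed
    then show ?thesis using mult_mat_vec_eq_iff[OF A[OF i] b[OF i]] by blast
  qed
  ultimately show ?thesis using w by blast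
qed

text \<open>The stacked product is the concatenation of the blocks \<open>A i *\<^sub>v z\<close>.
  Corresponding blocks have equal lengths, so an equation of concatenations splits
  blockwise.\<close>

lemma stack_system_iff:
  assumes "\<And>i. i \<in> set is \<Longrightarrow> A i \<in> carrier_mat (d i) n" "\<And>i. i \<in> set is \<Longrightarrow> b i \<in> carrier_vec (d i)"
    and z: "z \<in> carrier_vec n"
  shows "stack_mats n (map A is) *\<^sub>v z = stack_vecs (map b is) \<longleftrightarrow> (\<forall>i\<in>set is. A i *\<^sub>v z = b i)"
proof -
  let ?rs = "concat (map rows (map A is))"
  have "set (rows (A i)) \<subseteq> carrier_vec n" if "i \<in> set is" for i
    using rows_carrier[of "A i"] assms(1)[OF that] by simp
  then have rs: "set ?rs \<subseteq> carrier_vec n" by auto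
  have "stack_mats n (map A is) *\<^sub>v z = vec_of_list (map (\<lambda>r. r \<bullet> z) ?rs)"
  proof (rule eq_vecI)
    fix l assume "l < dim_vec (vec_of_list (map (\<lambda>r. r \<bullet> z) ?rs))"
    then have l: "l < length ?rs" by simp
    have "?rs ! l \<in> carrier_vec n" using l rs nth_mem by blast
    then show "(stack_mats n (map A is) *\<^sub>v z) $ l = vec_of_list (map (\<lambda>r. r \<bullet> z) ?rs) $ l"
      using l by (simp add: stack_mats_def vec_of_list_index)
  qed (simp add: stack_mats_def)
  also have "map (\<lambda>r. r \<bullet> z) ?rs = concat (map (\<lambda>i. list_of_vec (A i *\<^sub>v z)) is)"
  proof -
    have "map (\<lambda>r. r \<bullet> z) (rows M) = list_of_vec (M *\<^sub>v z)" for M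
      by (auto simp: rows_def mult_mat_vec_def)
    then show ?thesis by (simp add: map_concat comp_def)
  qed
  finally have "stack_mats n (map A is) *\<^sub>v z = stack_vecs (map b is) \<longleftrightarrow>
    concat (map (\<lambda>i. list_of_vec (A i *\<^sub>v z)) is) = concat (map (\<lambda>i. list_of_vec (b i)) is)"
    using arg_cong[of "vec_of_list _" "vec_of_list _" list_of_vec] by (auto simp: stack_vecs_def list_vec comp_def)
  also have "\<dots> \<longleftrightarrow> (\<forall>i\<in>set is. A i *\<^sub>v z = b i)"
    using assms(1,2)
  proof (induction "is")
    case Nil
    then show ?case by simp
  next
    case (Cons i "is")
    have "length (list_of_vec (A i *\<^sub>v z)) = length (list_of_vec (b i))"
      using Cons.prems(1)[of i] Cons.prems(2)[of i] by auto
    then show ?case using Cons.IH Cons.prems by (simp) (metis vec_list)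
  qed
  finally show ?thesis .
qed

section \<open>One projected averaging update\<close>

context
  fixes n dd :: nat and A P :: "real mat" and b :: "real vec"
  assumes A: "A \<in> carrier_mat dd n" and P: "orthogonal_projection_mat n (mat_kernel A) P"
begin

text \<open>The correction is a multiple of a kernel vector, so \<open>A\<close> does not see
  it.\<close>

lemma projected_update_solution:
  assumes "x \<in> carrier_vec n" "g \<in> carrier_vec n" "A *\<^sub>v x = b"
  shows "A *\<^sub>v (x - c \<cdot>\<^sub>v (P *\<^sub>v g)) = b"
proof -
  have "P *\<^sub>v g \<in> mat_kernel A" using P assms unfolding orthogonal_projection_mat_def by blast
  then have p: "P *\<^sub>v g \<in> carrier_vec n" "A *\<^sub>v (P *\<^sub>v g) = 0\<^sub>v dd" using mat_kernelD[OF A] by auto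
  have "A *\<^sub>v (x - c \<cdot>\<^sub>v (P *\<^sub>v g)) = A *\<^sub>v x - c \<cdot>\<^sub>v (A *\<^sub>v (P *\<^sub>v g))"
    using p A assms by (simp add: mult_minus_distrib_mat_vec mult_mat_vec)
  also have "\<dots> = b" using p assms A by (auto simp: vec_eq_iff)
  finally show ?thesis .
qed

text \<open>Writing \<open>u\<close> for the updated value, the sum vanishes because it equals
  \<open>-2 (\<Sum>j\<in>S. Y j - u) \<bullet> (u - w)\<close>: the first factor is the defect of the projection, hence
  orthogonal to the kernel, which contains \<open>u - w\<close>.\<close>

lemma projected_average_identity:
  assumes S: "finite S" "S \<noteq> {}" and Y: "\<And>j. j \<in> S \<Longrightarrow> Y j \<in> carrier_vec n"
    and x: "x \<in> carrier_vec n" "A *\<^sub>v x = b" and w: "w \<in> carrier_vec n" "A *\<^sub>v w = b"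
    and u: "u = x - (1 / real (card S)) \<cdot>\<^sub>v (P *\<^sub>v (real (card S) \<cdot>\<^sub>v x - finsum_vec TYPE(real) n Y S))"
  shows "(\<Sum>j\<in>S. (coord_dist n u w)\<^sup>2 + (coord_dist n (Y j) u)\<^sup>2 - (coord_dist n (Y j) w)\<^sup>2) = 0"
proof -
  let ?c = "real (card S)"
  have c: "?c \<noteq> 0" using S by simp
  define F where "F = finsum_vec TYPE(real) n Y S"
  have F: "F \<in> carrier_vec n" unfolding F_def using Y by (auto intro: finsum_vec_closed)
  define g where "g = ?c \<cdot>\<^sub>v x - F"
  have g: "g \<in> carrier_vec n" using x F by (simp add: g_def)
  have Pg: "P *\<^sub>v g \<in> mat_kernel A" "\<And>v. v \<in> mat_kernel A \<Longrightarrow> (g - P *\<^sub>v g) \<bullet> v = 0"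
    using P g unfolding orthogonal_projection_mat_def by auto
  have Pc: "P \<in> carrier_mat n n" using P unfolding orthogonal_projection_mat_def by blast
  have Pgc: "P *\<^sub>v g \<in> carrier_vec n" using mat_kernelD[OF A] Pg(1) by auto
  have u': "u = x - (1 / ?c) \<cdot>\<^sub>v (P *\<^sub>v g)" using u by (simp add: g_def F_def)
  have uc: "u \<in> carrier_vec n" using x Pgc by (simp add: u')
  have Au: "A *\<^sub>v u = b" unfolding u' by (rule projected_update_solution[OF x(1) g x(2)])
  have "A *\<^sub>v (u - w) = A *\<^sub>v u - A *\<^sub>v w" using A uc w by (simp add: mult_minus_distrib_mat_vec)
  also have "\<dots> = 0\<^sub>v dd" using A w(2) Au by auto
  finally have "u - w \<in> mat_kernel A" using uc w by (intro mat_kernelI[OF A]) auto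
  then have "(g - P *\<^sub>v g) \<bullet> (u - w) = 0" by (rule Pg(2))
  moreover have "(g - P *\<^sub>v g) \<bullet> (u - w) = (\<Sum>l<n. (g $ l - (P *\<^sub>v g) $ l) * (u $ l - w $ l))"
    using g Pgc uc w Pc by (auto simp: scalar_prod_def atLeast0LessThan intro!: sum.cong)
  ultimately have "(\<Sum>l<n. (g $ l - (P *\<^sub>v g) $ l) * (u $ l - w $ l)) = 0" by simp
  \<comment> \<open>The update rule gives \<open>?c * u = ?c * x - P *\<^sub>v g\<close> in each
    coordinate, so the defect of the projection is \<open>?c * u\<close> minus the sum of the
    inputs.\<close>
  moreover have "g $ l - (P *\<^sub>v g) $ l = - (\<Sum>j\<in>S. Y j $ l - u $ l)" if l: "l < n" for l
  proof -
    have "F $ l = (\<Sum>j\<in>S. Y j $ l)" unfolding F_def using Y S l by (intro index_finsum_vec) auto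
    moreover have "?c * u $ l = ?c * x $ l - (P *\<^sub>v g) $ l"
      using l x Pgc Pc c unfolding u' by (simp add: algebra_simps)
    moreover have "g $ l = ?c * x $ l - F $ l" using l x F by (simp add: g_def)
    ultimately show ?thesis by (simp add: sum_subtractf)
  qed
  ultimately have "(\<Sum>l<n. \<Sum>j\<in>S. (Y j $ l - u $ l) * (u $ l - w $ l)) = 0"
    by (simp add: sum_negf sum_distrib_right)
  then have o: "(\<Sum>j\<in>S. \<Sum>l<n. (Y j $ l - u $ l) * (u $ l - w $ l)) = 0"
    by (subst sum.swap)
  \<comment> \<open>Polarization, \<open>|a|\<^sup>2 + |b|\<^sup>2 - |a + b|\<^sup>2 = -2 a
    \<bullet> b\<close>, with \<open>a = u - w\<close> and \<open>b = Y j - u\<close>.\<close>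
  have eq: "(coord_dist n u w)\<^sup>2 + (coord_dist n (Y j) u)\<^sup>2 - (coord_dist n (Y j) w)\<^sup>2
      = - 2 * (\<Sum>l<n. (Y j $ l - u $ l) * (u $ l - w $ l))" for j
  proof -
    have "(coord_dist n u w)\<^sup>2 + (coord_dist n (Y j) u)\<^sup>2 - (coord_dist n (Y j) w)\<^sup>2
        = (\<Sum>l<n. (u $ l - w $ l)\<^sup>2 + (Y j $ l - u $ l)\<^sup>2 - (Y j $ l - w $ l)\<^sup>2)"
      by (simp add: coord_dist_power2 sum.distrib sum_subtractf)
    also have "\<dots> = (\<Sum>l<n. - 2 * ((Y j $ l - u $ l) * (u $ l - w $ l)))"
      by (rule sum.cong) (simp_all add: power2_eq_square algebra_simps)
    also have "\<dots> = - 2 * (\<Sum>l<n. (Y j $ l - u $ l) * (u $ l - w $ l))"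
      by (rule sum_distrib_left[symmetric])
    finally show ?thesis .
  qed
  show ?thesis unfolding eq sum_distrib_left[symmetric] o by simp
qed

end

section \<open>The common time scale\<close>

lemma event_gap:
  fixes s :: "nat \<Rightarrow> real"
  assumes "\<forall>k\<ge>1. T \<le> s (k + 1) - s k" "1 \<le> j" "j \<le> k"
  shows "real (k - j) * T \<le> s k - s j"
  using assms(3)
proof (induction k rule: dec_induct)
  case (step k)
  have "T \<le> s (k + 1) - s k" using assms(1,2) step.hyps by auto
  then show ?case using step by (simp add: Suc_diff_le algebra_simps)
qed simp

lemma event_unbounded:
  fixes s :: "nat \<Rightarrow> real"
  assumes gap: "\<forall>k\<ge>1. T \<le> s (k + 1) - s k" and T: "0 < T"
  shows "\<exists>k\<ge>k0. X \<le> s k"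
proof -
  obtain l where l: "X - s 1 \<le> real l * T" using T reals_Archimedean3 less_imp_le by blast
  define k where "k = max k0 (Suc l)"
  have "real l * T \<le> real (k - 1) * T" using T by (intro mult_right_mono) (auto simp: k_def)
  also have "\<dots> \<le> s k - s 1" by (rule event_gap[OF gap]) (auto simp: k_def)
  finally show ?thesis using l by (intro exI[of _ k]) (auto simp: k_def)
qed

text \<open>Event times are unbounded, so there is a least index from \<open>k0\<close> on whose
  event lies after \<open>X\<close>; its predecessor is the event whose value is in force at
  \<open>X\<close>.\<close>

lemma last_event:
  fixes s :: "nat \<Rightarrow> real"
  assumes gap: "\<forall>k\<ge>1. T \<le> s (k + 1) - s k" and T: "0 < T" and X: "s k0 \<le> X"
  shows "\<exists>k\<ge>k0. s k \<le> X \<and> X < s (k + 1)"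
proof -
  obtain k1 where "k0 \<le> k1" "X + 1 \<le> s k1" using event_unbounded[OF gap T, of k0 "X + 1"] by blast
  then have ex: "\<exists>k. k0 \<le> k \<and> X < s k" by (intro exI[of _ k1]) auto
  define k where "k = (LEAST k. k0 \<le> k \<and> X < s k)"
  have k: "k0 \<le> k" "X < s k" using LeastI_ex[OF ex] by (auto simp: k_def)
  then have "k \<noteq> k0" using X by auto
  then have "k0 \<le> k - 1" "k - 1 < k" using k(1) by auto
  then have "s (k - 1) \<le> X" using not_less_Least[of "k - 1" "\<lambda>k. k0 \<le> k \<and> X < s k"] by (auto simp: k_def)
  then show ?thesis using k \<open>k0 \<le> k - 1\<close> \<open>k - 1 < k\<close> by (intro exI[of _ "k - 1"]) auto
qed

text \<open>Event \<open>k\<close> comes at least \<open>(k - k0) * T\<close> after the first event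
  \<open>k0\<close> of the window, which limits \<open>k - k0\<close> to \<open>H / T\<close>; the
  extra 1 counts \<open>k0\<close> itself.\<close>

lemma card_events_le:
  fixes s :: "nat \<Rightarrow> real"
  assumes gap: "\<forall>k\<ge>1. T \<le> s (k + 1) - s k" and T: "0 < T"
  shows "finite {k. 1 \<le> k \<and> lo \<le> s k \<and> s k \<le> lo + H}"
    and "card {k. 1 \<le> k \<and> lo \<le> s k \<and> s k \<le> lo + H} \<le> nat \<lfloor>H / T\<rfloor> + 1"
proof -
  let ?K = "{k. 1 \<le> k \<and> lo \<le> s k \<and> s k \<le> lo + H}"
  \<comment> \<open>If no event falls into the window, \<open>k0\<close> is arbitrary and the
    inclusion below is trivial.\<close>
  define k0 where "k0 = (LEAST k. k \<in> ?K)"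
  have sub: "?K \<subseteq> {k0..k0 + nat \<lfloor>H / T\<rfloor>}"
  proof
    fix k assume k: "k \<in> ?K"
    have k0: "k0 \<in> ?K" unfolding k0_def using k by (rule LeastI)
    have le: "k0 \<le> k" unfolding k0_def using k by (rule Least_le)
    have "real (k - k0) * T \<le> H" using event_gap[OF gap _ le] k k0 by auto
    then have "real (k - k0) \<le> H / T" using T by (simp add: field_simps)
    then have "k - k0 \<le> nat \<lfloor>H / T\<rfloor>" by (simp add: le_nat_floor)
    then show "k \<in> {k0..k0 + nat \<lfloor>H / T\<rfloor>}" using le by auto
  qed
  then show "finite ?K" by (rule finite_subset) simp
  show "card ?K \<le> nat \<lfloor>H / T\<rfloor> + 1" using card_mono[OF _ sub] by simp
qed

text \<open>On the common time scale the delay of an update is bounded by a number of events, since no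
  agent has more than \<open>2 Tbar i / T j + 1\<close> events within two steps of another.\<close>

lemma bounded_lookback:
  assumes m: "m \<ge> 1" and bounds: "\<forall>i \<in> {1..m}. 0 < T i"
    and gaps: "\<forall>i \<in> {1..m}. \<forall>k \<ge> 1. T i \<le> t i (k + 1) - t i k \<and> t i (k + 1) - t i k \<le> Tbar i"
    and \<tau>: "increasing_enumeration \<tau> (common_event_times m t)"
  shows "\<exists>p0 B. \<forall>i\<in>{1..m}. \<forall>p\<ge>p0. \<exists>k q. 2 \<le> k \<and> 1 \<le> q \<and> q < p \<and> p \<le> q + B \<and>
    \<tau> q = t i k \<and> t i (k + 1) \<le> \<tau> p \<and> \<tau> p < t i (k + 2)"
proof -
  define t1 where "t1 = Max ((\<lambda>i. t i 1) ` {1..m})"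
  have gap: "\<forall>k\<ge>1. T i \<le> t i (k + 1) - t i k" if "i \<in> {1..m}" for i using gaps that by blast
  have pos: "0 < T i" if "i \<in> {1..m}" for i using bounds that by blast
  have mono: "strict_mono_on {1..} \<tau>" and range: "\<tau> ` {1..} = common_event_times m t"
    using \<tau> by (auto simp: increasing_enumeration_def)
  have event: "\<exists>q\<ge>1. \<tau> q = t i k" if "i \<in> {1..m}" "1 \<le> k" "t1 \<le> t i k" for i k
  proof -
    have "t i k \<in> common_event_times m t" using that by (auto simp: common_event_times_def t1_def)
    then show ?thesis unfolding range[symmetric] by auto
  qed
  \<comment> \<open>\<open>2 \<le> k\<close> avoids the first update, which does not use the fixed
    neighbor set, and \<open>t1 \<le> t i k\<close> puts the reading event on the common
    scale.\<close>
  have "\<exists>k p. 2 \<le> k \<and> 1 \<le> p \<and> t1 \<le> t i k \<and> \<tau> p = t i (k + 1)" if i: "i \<in> {1..m}" for i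
  proof -
    obtain k where k: "2 \<le> k" "t1 \<le> t i k" using event_unbounded[OF gap[OF i] pos[OF i]] by blast
    moreover have "t i k \<le> t i (k + 1)" using gap[OF i, rule_format, of k] pos[OF i] k by simp
    ultimately show ?thesis using event[OF i, of "k + 1"] by fastforce
  qed
  then obtain ks ps where ks: "\<And>i. i \<in> {1..m} \<Longrightarrow> 2 \<le> ks i \<and> 1 \<le> ps i \<and> t1 \<le> t i (ks i) \<and> \<tau> (ps i) = t i (ks i + 1)"
    by metis
  \<comment> \<open>Sums of natural numbers serve as upper bounds common to all agents, here and for
    \<open>B\<close>.\<close>
  define p0 where "p0 = (\<Sum>i\<in>{1..m}. ps i)"
  define B where "B = (\<Sum>i\<in>{1..m}. \<Sum>j\<in>{1..m}. nat \<lfloor>2 * Tbar i / T j\<rfloor> + 1)"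
  have "\<exists>k q. 2 \<le> k \<and> 1 \<le> q \<and> q < p \<and> p \<le> q + B \<and>
    \<tau> q = t i k \<and> t i (k + 1) \<le> \<tau> p \<and> \<tau> p < t i (k + 2)" if i: "i \<in> {1..m}" and p: "p0 \<le> p" for i p
  proof -
    have "ps i \<le> p0" unfolding p0_def using i by (intro member_le_sum) auto
    then have psp: "ps i \<le> p" "1 \<le> ps i" using p ks[OF i] by auto
    then have "\<tau> (ps i) \<le> \<tau> p"
      using strict_mono_on_leD[OF mono, of "ps i" p] by auto
    then have "t i (ks i + 1) \<le> \<tau> p" using ks[OF i] by simp
    from last_event[OF gap[OF i] pos[OF i] this] obtain k'
      where k': "ks i + 1 \<le> k'" "t i k' \<le> \<tau> p" "\<tau> p < t i (k' + 1)" by blast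
    \<comment> \<open>Event \<open>k'\<close> produced the value in force at
      \<open>\<tau> p\<close>; the states entering it were read one event earlier.\<close>
    define k where "k = k' - 1"
    have k: "ks i \<le> k" "2 \<le> k" "t i (k + 1) \<le> \<tau> p" "\<tau> p < t i (k + 2)" using k' ks[OF i] by (auto simp: k_def)
    have "0 \<le> real (k - ks i) * T i" using pos[OF i] by simp
    also have "\<dots> \<le> t i k - t i (ks i)" by (rule event_gap[OF gap[OF i]]) (use k ks[OF i] in auto)
    finally have "t1 \<le> t i k" using ks[OF i] by simp
    then obtain q where q: "1 \<le> q" "\<tau> q = t i k" using event[OF i, of k] k by auto
    have "t i k < t i (k + 1)" using gap[OF i, rule_format, of k] pos[OF i] k by simp
    then have "\<tau> q < \<tau> p" using q k by simp
    then have qp: "q < p"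
      using strict_mono_on_leD[OF mono, of p q] q(1) psp by (cases "q < p") auto
    have "t i (k + 2) \<le> t i k + 2 * Tbar i"
      using gaps[rule_format, OF i, of k] gaps[rule_format, OF i, of "k + 1"] k by simp
    then have H: "\<tau> p \<le> \<tau> q + 2 * Tbar i" using k q by simp
    let ?K = "\<lambda>j. {k. 1 \<le> k \<and> \<tau> q \<le> t j k \<and> t j k \<le> \<tau> q + 2 * Tbar i}"
    have fin: "finite (?K j)" if "j \<in> {1..m}" for j using card_events_le(1)[OF gap pos] that by blast
    \<comment> \<open>Every index in \<open>{q<..p}\<close> is an event of some agent in this time
      span, and distinct indices have distinct times, so counting events bounds
      \<open>p - q\<close>.\<close>
    have "\<tau> ` {q<..p} \<subseteq> (\<Union>j\<in>{1..m}. t j ` ?K j)"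
    proof
      fix s assume "s \<in> \<tau> ` {q<..p}"
      then obtain r where r: "q < r" "r \<le> p" "s = \<tau> r" by auto
      have "\<tau> q \<le> s" "s \<le> \<tau> p"
        using strict_mono_on_leD[OF mono, of q r] strict_mono_on_leD[OF mono, of r p] r q by auto
      moreover have "s \<in> common_event_times m t" using r range
        by (metis image_eqI atLeast_iff le_trans less_imp_le q(1))
      then obtain j k where "j \<in> {1..m}" "1 \<le> k" "s = t j k" by (auto simp: common_event_times_def)
      ultimately show "s \<in> (\<Union>j\<in>{1..m}. t j ` ?K j)" using H by fastforce
    qed
    then have "card (\<tau> ` {q<..p}) \<le> card (\<Union>j\<in>{1..m}. t j ` ?K j)"
      using fin by (intro card_mono) auto
    also have "\<dots> \<le> (\<Sum>j\<in>{1..m}. card (t j ` ?K j))" by (rule card_UN_le) simp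
    also have "\<dots> \<le> (\<Sum>j\<in>{1..m}. nat \<lfloor>2 * Tbar i / T j\<rfloor> + 1)"
    proof (rule sum_mono)
      fix j assume j: "j \<in> {1..m}"
      show "card (t j ` ?K j) \<le> nat \<lfloor>2 * Tbar i / T j\<rfloor> + 1"
        using card_image_le[OF fin[OF j], of "t j"] card_events_le(2)[OF gap[OF j] pos[OF j], of "\<tau> q" "2 * Tbar i"]
        by linarith
    qed
    also have "\<dots> \<le> B" unfolding B_def
      using i by (intro member_le_sum[of i "{1..m}" "\<lambda>i. \<Sum>j\<in>{1..m}. nat \<lfloor>2 * Tbar i / T j\<rfloor> + 1"]) auto
    also have "card (\<tau> ` {q<..p}) = p - q"
    proof -
      have "inj_on \<tau> {q<..p}"
        by (rule inj_on_subset[OF strict_mono_on_imp_inj_on[OF mono]]) (use q in auto)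
      then show ?thesis by (simp add: card_image)
    qed
    finally have "p \<le> q + B" by simp
    then show ?thesis using k q qp by blast
  qed
  then show ?thesis by blast
qed

section \<open>Convergence\<close>

theorem corollary2:
  fixes m n :: nat
    and d :: "nat \<Rightarrow> nat"
    and A P :: "nat \<Rightarrow> real mat"
    and b :: "nat \<Rightarrow> real vec"
    and N :: "nat pair_pre_digraph"
    and t :: "nat \<Rightarrow> nat \<Rightarrow> real"
    and T Tbar :: "nat \<Rightarrow> real"
    and nbrs :: "nat \<Rightarrow> real \<Rightarrow> nat set"
    and x :: "nat \<Rightarrow> real \<Rightarrow> real vec"
    and \<tau> :: "nat \<Rightarrow> real"
  assumes m: "m > 1" and n: "n \<ge> 1"
    and A: "\<forall>i \<in> {1..m}. A i \<in> carrier_mat (d i) n"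
    and b: "\<forall>i \<in> {1..m}. b i \<in> carrier_vec (d i)"
    and solvable: "\<exists>z \<in> carrier_vec n. stack_mats n (map A [1..<m + 1]) *\<^sub>v z = stack_vecs (map b [1..<m + 1])"
    and P: "\<forall>i \<in> {1..m}. orthogonal_projection_mat n (mat_kernel (A i)) (P i)"
    and N_graph: "pair_wf_digraph N" "pverts N = {1..m}"
    and N_self_arcs: "\<forall>i \<in> {1..m}. (i, i) \<in> parcs N"
    and N_connected: "strongly_connected (with_proj N)"
    and event_start: "\<forall>i \<in> {1..m}. t i 1 \<ge> 0"
    and event_increasing: "\<forall>i \<in> {1..m}. \<forall>k \<ge> 1. t i k < t i (k + 1)"
    and event_bounds: "\<forall>i \<in> {1..m}. 0 < T i \<and> T i < Tbar i"
    and event_gaps: "\<forall>i \<in> {1..m}. \<forall>k \<ge> 1. T i \<le> t i (k + 1) - t i k \<and> t i (k + 1) - t i k \<le> Tbar i"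
    and nbrs_first: "\<forall>i \<in> {1..m}. nbrs i (t i 1) = {i}"
    and nbrs_later: "\<forall>i \<in> {1..m}. \<forall>k > 1. nbrs i (t i k) = in_neighbors N i"
    and nbrs_defined: "\<forall>i \<in> {1..m}. \<forall>k > 1. \<forall>j \<in> nbrs i (t i k). t j 1 \<le> t i k"
    and x_dim: "\<forall>i \<in> {1..m}. \<forall>s \<ge> t i 1. x i s \<in> carrier_vec n"
    and x_const: "\<forall>i \<in> {1..m}. \<forall>k \<ge> 1. \<forall>s \<in> {t i k..<t i (k + 1)}. x i s = x i (t i k)"
    and x_init: "\<forall>i \<in> {1..m}. A i *\<^sub>v x i (t i 1) = b i"
    and x_update: "\<forall>i \<in> {1..m}. \<forall>k \<ge> 1.
      x i (t i (k + 1)) = x i (t i k) - (1 / real (card (nbrs i (t i k)))) \<cdot>\<^sub>v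
        (P i *\<^sub>v (real (card (nbrs i (t i k))) \<cdot>\<^sub>v x i (t i k) -
          finsum_vec TYPE(real) n (\<lambda>j. x j (t i k)) (nbrs i (t i k))))"
    and \<tau>: "increasing_enumeration \<tau> (common_event_times m t)"
  shows "\<exists>r. 0 < r \<and> r < 1 \<and>
    (\<exists>x_inf \<in> carrier_vec n.
      stack_mats n (map A [1..<m + 1]) *\<^sub>v x_inf = stack_vecs (map b [1..<m + 1]) \<and>
      (\<forall>i \<in> {1..m}. converges_as_fast_as_power (\<lambda>p. x i (\<tau> p)) x_inf r))"
proof -
  let ?I = "{1..m}"
  define W where "W = {w \<in> carrier_vec n. \<forall>i\<in>?I. A i *\<^sub>v w = b i}"
  have stacked: "stack_mats n (map A [1..<m + 1]) *\<^sub>v z = stack_vecs (map b [1..<m + 1])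
      \<longleftrightarrow> (\<forall>i\<in>?I. A i *\<^sub>v z = b i)" if "z \<in> carrier_vec n" for z
  proof -
    have set_upt: "set [1..<m + 1] = ?I" by auto
    show ?thesis using stack_system_iff[of "[1..<m + 1]" A d n b, unfolded set_upt] A b that by blast
  qed
  obtain z where z: "z \<in> W" using solvable stacked by (auto simp: W_def)

  \<comment> \<open>Each state solves its own agent's equation\<close>
  have gap: "\<forall>k\<ge>1. T i \<le> t i (k + 1) - t i k" if "i \<in> ?I" for i using event_gaps that by blast
  have pos: "0 < T i" if "i \<in> ?I" for i using event_bounds that by blast
  have first: "t i 1 \<le> t i k" if "i \<in> ?I" "1 \<le> k" for i k
  proof -
    have "0 \<le> real (k - 1) * T i" using pos[OF that(1)] by simp
    also have "\<dots> \<le> t i k - t i 1" by (rule event_gap[OF gap[OF that(1)]]) (use that in auto)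
    finally show ?thesis by simp
  qed
  have in_nbrs: "in_neighbors N i \<subseteq> ?I" for i
    using pair_wf_digraph.in_arcsD1[OF N_graph(1)] N_graph(2)
    by (auto simp: in_neighbors_def)
  \<comment> \<open>The first update reads only the agent's own state; later ones read the fixed
    neighbors, whose states are defined by then. Either way the vectors read have dimension
    \<open>n\<close>.\<close>
  have nbrs: "finite (nbrs i (t i k))" "nbrs i (t i k) \<noteq> {}"
      "\<And>j. j \<in> nbrs i (t i k) \<Longrightarrow> x j (t i k) \<in> carrier_vec n"
    if i: "i \<in> ?I" and k: "1 \<le> k" for i k
  proof -
    have "nbrs i (t i k) \<subseteq> ?I \<and> i \<in> nbrs i (t i k) \<and> (\<forall>j\<in>nbrs i (t i k). t j 1 \<le> t i k)"
    proof (cases "k = 1")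
      case True
      then show ?thesis using nbrs_first i by simp
    next
      case False
      then have "nbrs i (t i k) = in_neighbors N i" using nbrs_later i k by simp
      moreover have "i \<in> in_neighbors N i" using N_self_arcs i by (simp add: in_neighbors_def)
      ultimately show ?thesis using in_nbrs nbrs_defined i k False by simp
    qed
    then show "finite (nbrs i (t i k))" "nbrs i (t i k) \<noteq> {}"
      "\<And>j. j \<in> nbrs i (t i k) \<Longrightarrow> x j (t i k) \<in> carrier_vec n"
      using finite_subset x_dim by blast+
  qed
  have event_solves: "A i *\<^sub>v x i (t i k) = b i" if i: "i \<in> ?I" and k: "1 \<le> k" for i k
    using k
  proof (induction k rule: dec_induct)
    case base
    then show ?case using x_init i by simp
  next
    case (step k)
    have "x i (t i k) \<in> carrier_vec n" using x_dim i first[OF i step.hyps(1)] by blast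
    moreover have "finsum_vec TYPE(real) n (\<lambda>j. x j (t i k)) (nbrs i (t i k)) \<in> carrier_vec n"
      using nbrs[OF i step.hyps(1)] by (auto intro: finsum_vec_closed)
    ultimately show ?case
      using projected_update_solution[of "A i" "d i" n "P i" "x i (t i k)"] A P i x_update step by simp
  qed
  have solves: "A i *\<^sub>v x i s = b i" if i: "i \<in> ?I" and s: "t i 1 \<le> s" for i s
  proof -
    obtain k where k: "1 \<le> k" "t i k \<le> s" "s < t i (k + 1)" using last_event[OF gap[OF i] pos[OF i] s] by blast
    then have "x i s = x i (t i k)" using x_const[rule_format, OF i k(1), of s] by simp
    then show ?thesis using event_solves[OF i k(1)] by simp
  qed

  \<comment> \<open>Passing to the common time scale\<close>
  have \<tau>_mono: "strict_mono_on {1..} \<tau>" and \<tau>_range: "\<tau> ` {1..} = common_event_times m t"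
    using \<tau> by (auto simp: increasing_enumeration_def)
  have \<tau>_ge: "t i 1 \<le> \<tau> p" if "i \<in> ?I" "1 \<le> p" for i p
  proof -
    have "\<tau> p \<in> common_event_times m t" using that \<tau>_range by auto
    then have "Max ((\<lambda>i. t i 1) ` ?I) \<le> \<tau> p" by (simp add: common_event_times_def)
    moreover have "t i 1 \<le> Max ((\<lambda>i. t i 1) ` ?I)" using that by (intro Max_ge) auto
    ultimately show ?thesis by simp
  qed
  have dim: "x i (\<tau> p) \<in> carrier_vec n" and sol: "A i *\<^sub>v x i (\<tau> p) = b i" if "i \<in> ?I" "1 \<le> p" for i p
    using x_dim solves \<tau>_ge that by blast+
  have "\<exists>p0 B. \<forall>i\<in>?I. \<forall>p\<ge>p0. \<exists>k q. 2 \<le> k \<and> 1 \<le> q \<and> q < p \<and> p \<le> q + B \<and>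
      \<tau> q = t i k \<and> t i (k + 1) \<le> \<tau> p \<and> \<tau> p < t i (k + 2)"
    by (rule bounded_lookback[OF _ _ event_gaps \<tau>]) (use m event_bounds in auto)
  then obtain p1 B where look: "\<And>i p. i \<in> ?I \<Longrightarrow> p1 \<le> p \<Longrightarrow> \<exists>k q. 2 \<le> k \<and> 1 \<le> q \<and> q < p \<and> p \<le> q + B \<and>
      \<tau> q = t i k \<and> t i (k + 1) \<le> \<tau> p \<and> \<tau> p < t i (k + 2)"
    by (elim exE) blast
  \<comment> \<open>\<open>\<tau> 0\<close> is unconstrained, so indices must start at 1.\<close>
  define p0 where "p0 = max 1 p1"
  obtain \<kappa> where \<kappa>: "0 \<le> \<kappa>" and eb: "\<And>v r. v \<in> carrier_vec n \<Longrightarrow>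
      (\<forall>i\<in>?I. \<exists>u\<in>carrier_vec n. A i *\<^sub>v u = b i \<and> coord_dist n v u \<le> r) \<Longrightarrow>
      (\<exists>w\<in>carrier_vec n. (\<forall>i\<in>?I. A i *\<^sub>v w = b i) \<and> coord_dist n v w \<le> \<kappa> * r)"
    using solution_set_error_bound[of ?I A d n b z] A b z unfolding W_def by auto
  have "delayed_averaging (coord_dist n) W ?I (parcs N) (\<lambda>i p. x i (\<tau> p)) p0 B \<kappa>"
  proof
    fix u :: "nat \<Rightarrow> real vec"
    assume "\<And>k. u k \<in> W" "\<And>e. 0 < e \<Longrightarrow> \<exists>K. \<forall>k\<ge>K. \<forall>l\<ge>K. coord_dist n (u k) (u l) < e"
    then show "\<exists>w\<in>W. (\<lambda>k. coord_dist n (u k) w) \<longlonglongrightarrow> 0"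
      using solution_set_complete[of ?I A d n b u] A b unfolding W_def by auto
  next
    show "W \<noteq> {}" using z by blast
    show "?I \<noteq> {}" using m by simp
    show "j \<in> ?I" if "(j, i) \<in> parcs N" for i j using in_nbrs[of i] that by (auto simp: in_neighbors_def)
    show "(i, i) \<in> parcs N" if "i \<in> ?I" for i using N_self_arcs that by blast
    show "(j, i) \<in> (parcs N)\<^sup>*" if "i \<in> ?I" "j \<in> ?I" for i j
    proof -
      have "(j, i) \<in> rtrancl_on ?I (parcs N)"
        using N_connected that N_graph(2) by (simp add: strongly_connected_def reachable_def)
      then show ?thesis by (rule rtrancl_on_rtranclI)
    qed
  next
    fix i p r
    assume i: "i \<in> ?I" and p: "p0 \<le> p"
      and near: "\<And>j. j \<in> ?I \<Longrightarrow> \<exists>p'\<ge>p0. coord_dist n (x i (\<tau> p)) (x j (\<tau> p')) \<le> r"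
    \<comment> \<open>The state of agent \<open>j\<close> near \<open>x i (\<tau> p)\<close> itself
      solves equation \<open>j\<close>, so it is the required \<open>u\<close>.\<close>
    have "\<forall>j\<in>?I. \<exists>u\<in>carrier_vec n. A j *\<^sub>v u = b j \<and> coord_dist n (x i (\<tau> p)) u \<le> r"
      using near dim sol unfolding p0_def by (meson max.bounded_iff)
    from eb[OF dim[OF i] this] p show "\<exists>w\<in>W. coord_dist n (x i (\<tau> p)) w \<le> \<kappa> * r"
      by (auto simp: p0_def W_def)
  next
    fix i p assume i: "i \<in> ?I" and p: "p0 + B \<le> p"
    have "p1 \<le> p" using p by (simp add: p0_def)
    from look[OF i this] obtain k q where k: "2 \<le> k" and q: "1 \<le> q" "q < p" "p \<le> q + B"
      and tq: "\<tau> q = t i k" and tp: "t i (k + 1) \<le> \<tau> p" "\<tau> p < t i (k + 2)" by blast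
    let ?S = "{j. (j, i) \<in> parcs N}"
    have S: "nbrs i (t i k) = ?S" using nbrs_later i k by (simp add: in_neighbors_def)
    \<comment> \<open>Between \<open>\<tau> q\<close> and \<open>\<tau> p\<close> agent
      \<open>i\<close> has its old value before \<open>t i (k + 1)\<close> and its new one from then
      on, which gives the two alternatives in \<open>step\<close>.\<close>
    have new: "x i s = x i (t i (k + 1))" if "t i (k + 1) \<le> s" "s \<le> \<tau> p" for s
      using x_const[rule_format, OF i, of "k + 1" s] tp that by simp
    have old: "x i s = x i (t i k)" if "t i k \<le> s" "s < t i (k + 1)" for s
      using x_const[rule_format, OF i, of k s] k that by simp
    have "(\<Sum>j\<in>?S. (coord_dist n (x i (\<tau> p)) w)\<^sup>2 + (coord_dist n (x j (\<tau> q)) (x i (\<tau> p)))\<^sup>2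
        - (coord_dist n (x j (\<tau> q)) w)\<^sup>2) = 0" if w: "w \<in> W" for w
    proof (rule projected_average_identity[of "A i" "d i" n "P i" ?S "\<lambda>j. x j (\<tau> q)" "x i (t i k)" "b i"])
      show "x i (\<tau> p) = x i (t i k) - (1 / real (card ?S)) \<cdot>\<^sub>v (P i *\<^sub>v
          (real (card ?S) \<cdot>\<^sub>v x i (t i k) - finsum_vec TYPE(real) n (\<lambda>j. x j (\<tau> q)) ?S))"
        using x_update[rule_format, OF i, of k] k new[of "\<tau> p"] tp unfolding S tq by simp
    qed (use A P i w nbrs[OF i, of k] k event_solves[OF i, of k] first[OF i, of k] x_dim in
        \<open>auto simp: S tq W_def\<close>)
    moreover have "x i (\<tau> p') = x i (\<tau> p) \<or> x i (\<tau> p') = x i (\<tau> q)" if "p' \<in> {q..p}" for p'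
    proof -
      have "\<tau> q \<le> \<tau> p'" "\<tau> p' \<le> \<tau> p" using that q by (auto intro!: strict_mono_on_leD[OF \<tau>_mono])
      then show ?thesis
        using new[of "\<tau> p'"] new[of "\<tau> p"] old[of "\<tau> p'"] tp tq by (cases "\<tau> p' < t i (k + 1)") auto
    qed
    ultimately show "\<exists>q<p. p \<le> q + B \<and>
      (\<forall>w\<in>W. (\<Sum>j | (j, i) \<in> parcs N. (coord_dist n (x i (\<tau> p)) w)\<^sup>2
        + (coord_dist n (x j (\<tau> q)) (x i (\<tau> p)))\<^sup>2 - (coord_dist n (x j (\<tau> q)) w)\<^sup>2) \<le> 0) \<and>
      (\<forall>p'\<in>{q..p}. x i (\<tau> p') = x i (\<tau> p) \<or> x i (\<tau> p') = x i (\<tau> q))"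
      using q by (intro exI[of _ q]) auto
  qed (use \<kappa> coord_dist_nonneg coord_dist_self coord_dist_commute coord_dist_triangle in auto)
  from delayed_averaging.exponential_convergence[OF this] obtain r w where r: "0 < r" "r < 1"
    and w: "w \<in> W" and conv: "\<And>i. i \<in> ?I \<Longrightarrow> \<exists>c. \<forall>p. coord_dist n (x i (\<tau> p)) w \<le> c * r ^ p"
    by blast
  have "converges_as_fast_as_power (\<lambda>p. x i (\<tau> p)) w r" if i: "i \<in> ?I" for i
  proof -
    obtain c where "\<And>p. coord_dist n (x i (\<tau> p)) w \<le> c * r ^ p" using conv[OF i] by blast
    then have "\<forall>p\<ge>1. norm2_vec (x i (\<tau> p) - w) \<le> c * r ^ p"
      using norm2_vec_diff[OF dim[OF i]] w unfolding W_def by simp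
    then show ?thesis unfolding converges_as_fast_as_power_def by blast
  qed
  then show ?thesis using r w stacked unfolding W_def by blast
qed

end
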